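(* Let $B$ be a unital algebra over $\mathbb{C}$ and $B\langle X\rangle=B*_{\mathbb{C}}\mathbb{C}\langle X\rangle$. The sequence of linear maps $$0\to B+[B\langle X\rangle,B\langle X\rangle]\to B\langle X\rangle\xrightarrow{\ \delta_{X:B}\ }B\langle X\rangle\xrightarrow{\ \Theta\ }B\langle X\rangle,$$ whose first nontrivial map is the inclusion, is exact.
   Context: $B*_{\mathbb{C}}\mathbb{C}\langle X\rangle$ is the algebraic free product (amalgamated over $\mathbb{C}1$) of $B$ and the polynomial algebra in one indeterminate $X$; it is spanned by monomials $b_0Xb_1X\cdots Xb_n$ with $n\ge0$, $b_i\in B$. The free difference quotient $\partial_{X:B}:B\langle X\rangle\to B\langle X\rangle\otimes B\langle X\rangle$ is the derivation with $\partial_{X:B}[X]=1\otimes1$ and $\partial_{X:B}[b]=0$ for $b\in B$, i.e. $\partial_{X:B}[b_0Xb_1\cdots Xb_n]=\sum_{i=1}^{n}b_0X\cdots Xb_{i-1}\otimes b_iX\cdots Xb_n$. The cyclic derivative is $\delta_{X:B}=\mu\circ\sigma\circ\partial_{X:B}$ with $\sigma(p\otimes q)=q\otimes p$ and $\mu(p\otimes q)=pq$. $\Theta=\mathrm{id}-\rho$, where $\rho:B\langle X\rangle\to B\langle X\rangle$ is the linear map with $\rho[b_0Xb_1\cdots Xb_n]=b_1Xb_2\cdots Xb_nXb_0$. $[B\langle X\rangle,B\langle X\rangle]$ denotes the linear span of all commutators. *)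

theory Defs
  imports Complex_Main "HOL-Library.Poly_Mapping" "HOL-Computational_Algebra.Polynomial"
begin

section \<open>Complex vector spaces and unital complex algebras\<close>

class scaleC =
  fixes scaleC :: "complex \<Rightarrow> 'a \<Rightarrow> 'a"  (infixr \<open>*\<^sub>C\<close> 75)

class complex_vector = scaleC + ab_group_add +
  assumes scaleC_add_right: "a *\<^sub>C (x + y) = a *\<^sub>C x + a *\<^sub>C y"
    and scaleC_add_left: "(a + b) *\<^sub>C x = a *\<^sub>C x + b *\<^sub>C x"
    and scaleC_scaleC: "a *\<^sub>C b *\<^sub>C x = (a * b) *\<^sub>C x"
    and scaleC_one: "1 *\<^sub>C x = x"

text \<open>The multiplication need not be commutative.  Building on \<^class>\<open>ring\<close> and
  \<^class>\<open>monoid_mult\<close> instead of \<^class>\<open>ring_1\<close> avoids the axiom \<^prop>\<open>0 \<noteq> 1\<close>, so that the zero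
  algebra is not excluded.\<close>

class complex_algebra_1 = complex_vector + ring + monoid_mult +
  assumes mult_scaleC_left: "a *\<^sub>C x * y = a *\<^sub>C (x * y)"
    and mult_scaleC_right: "x * a *\<^sub>C y = a *\<^sub>C (x * y)"

global_interpretation complex_vector: vector_space "scaleC :: complex \<Rightarrow> 'a \<Rightarrow> 'a :: complex_vector"
  by unfold_locales (simp_all add: scaleC_add_right scaleC_add_left scaleC_scaleC scaleC_one)

abbreviation clinear :: "('a::complex_vector \<Rightarrow> 'b::complex_vector) \<Rightarrow> bool"
  where "clinear \<equiv> Vector_Spaces.linear scaleC scaleC"

instantiation complex :: complex_algebra_1
begin

definition scaleC_complex_def [simp]: "scaleC a (x::complex) = a * x"

instance
  by standard (simp_all add: algebra_simps)

end

text \<open>For complex polynomials this is the usual scalar multiplication, see \<open>scaleC_complex_poly\<close>.\<close>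

instantiation poly :: ("{comm_ring_1, complex_algebra_1}") complex_algebra_1
begin

definition scaleC_poly_def: "scaleC a (p :: 'a poly) = smult (a *\<^sub>C 1) p"

instance
  by standard
    (simp_all add: scaleC_poly_def smult_add_right smult_add_left scaleC_add_left scaleC_one
      scaleC_scaleC mult_scaleC_left)

end

lemma scaleC_complex_poly: "a *\<^sub>C (p :: complex poly) = smult a p"
  by (simp add: scaleC_poly_def)

instantiation poly_mapping :: (type, complex_vector) complex_vector
begin

lift_definition scaleC_poly_mapping :: "complex \<Rightarrow> ('a \<Rightarrow>\<^sub>0 'b) \<Rightarrow> 'a \<Rightarrow>\<^sub>0 'b"
  is "\<lambda>c f k. c *\<^sub>C f k"
  by (erule rev_finite_subset) auto

instance
  by (standard; transfer)
    (simp_all add: fun_eq_iff scaleC_add_right scaleC_add_left scaleC_scaleC scaleC_one)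

end

lemma update_eq_add_single:
  assumes "a \<notin> Poly_Mapping.keys f"
  shows "Poly_Mapping.update a b f = f + Poly_Mapping.single a b"
  using assms
  by (intro poly_mapping_eqI) (auto simp: lookup_update lookup_add lookup_single when_def in_keys_iff)

lemma scaleC_single: "c *\<^sub>C Poly_Mapping.single a b = Poly_Mapping.single a (c *\<^sub>C b)"
  by (intro poly_mapping_eqI) (auto simp: scaleC_poly_mapping.rep_eq lookup_single when_def)

lemma scaleC_poly_mapping_eq_mult:
  fixes p :: "'g::monoid_add \<Rightarrow>\<^sub>0 complex"
  shows "c *\<^sub>C p = Poly_Mapping.single 0 c * p" and "c *\<^sub>C p = p * Poly_Mapping.single 0 c"
proof (induction p rule: update_induct)
  case const
  show "c *\<^sub>C 0 = Poly_Mapping.single 0 c * (0 :: 'g \<Rightarrow>\<^sub>0 complex)"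
    and "c *\<^sub>C 0 = (0 :: 'g \<Rightarrow>\<^sub>0 complex) * Poly_Mapping.single 0 c"
    by simp_all
next
  case (update f a b)
  note eqs = update_eq_add_single[OF update(1)] scaleC_add_right scaleC_single mult_single
  show "c *\<^sub>C Poly_Mapping.update a b f = Poly_Mapping.single 0 c * Poly_Mapping.update a b f"
    by (simp add: eqs distrib_left update(3))
  show "c *\<^sub>C Poly_Mapping.update a b f = Poly_Mapping.update a b f * Poly_Mapping.single 0 c"
    by (simp add: eqs distrib_right update(4)[symmetric] mult.commute)
qed


section \<open>The tensor product of complex vector spaces\<close>

definition tensor_relations :: "('a::complex_vector \<times> 'b::complex_vector \<Rightarrow>\<^sub>0 complex) set" where
  "tensor_relations =
     (let e = \<lambda>a b. Poly_Mapping.single (a, b) 1 in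
       {e (a + a') b - e a b - e a' b | a a' b. True} \<union>
       {e a (b + b') - e a b - e a b' | a b b'. True} \<union>
       {e (c *\<^sub>C a) b - c *\<^sub>C e a b | c a b. True} \<union>
       {e a (c *\<^sub>C b) - c *\<^sub>C e a b | c a b. True})"

quotient_type (overloaded) ('a, 'b) tensor =
    "'a::complex_vector \<times> 'b::complex_vector \<Rightarrow>\<^sub>0 complex" /
    "\<lambda>p q. p - q \<in> complex_vector.span tensor_relations"
proof (rule equivpI)
  show "reflp (\<lambda>p q :: 'a \<times> 'b \<Rightarrow>\<^sub>0 complex. p - q \<in> complex_vector.span tensor_relations)"
    by (rule reflpI) (simp add: complex_vector.span_zero)
  show "symp (\<lambda>p q :: 'a \<times> 'b \<Rightarrow>\<^sub>0 complex. p - q \<in> complex_vector.span tensor_relations)"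
    by (rule sympI) (metis complex_vector.span_neg minus_diff_eq)
  show "transp (\<lambda>p q :: 'a \<times> 'b \<Rightarrow>\<^sub>0 complex. p - q \<in> complex_vector.span tensor_relations)"
    by (rule transpI) (drule (1) complex_vector.span_add, simp)
qed

instantiation tensor :: (complex_vector, complex_vector) complex_vector
begin

lift_definition zero_tensor :: "('a, 'b) tensor" is 0 .

lift_definition plus_tensor :: "('a, 'b) tensor \<Rightarrow> ('a, 'b) tensor \<Rightarrow> ('a, 'b) tensor" is "(+)"
  by (metis add_diff_add complex_vector.span_add)

lift_definition minus_tensor :: "('a, 'b) tensor \<Rightarrow> ('a, 'b) tensor \<Rightarrow> ('a, 'b) tensor" is "(-)"
  by (drule (1) complex_vector.span_diff) (simp add: algebra_simps)

lift_definition uminus_tensor :: "('a, 'b) tensor \<Rightarrow> ('a, 'b) tensor" is uminus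
  by (metis complex_vector.span_neg minus_diff_minus)

lift_definition scaleC_tensor :: "complex \<Rightarrow> ('a, 'b) tensor \<Rightarrow> ('a, 'b) tensor" is scaleC
  by (metis complex_vector.scale_right_diff_distrib complex_vector.span_scale)

instance
  by (standard; transfer)
    (simp_all add: algebra_simps complex_vector.span_zero scaleC_add_right scaleC_add_left
      scaleC_scaleC scaleC_one)

end

lift_definition pure_tensor :: "'a::complex_vector \<Rightarrow> 'b::complex_vector \<Rightarrow> ('a, 'b) tensor"
    (infixr \<open>\<otimes>\<^sub>C\<close> 70)
  is "\<lambda>a b. Poly_Mapping.single (a, b) 1" .

text \<open>The linear map out of the tensor product that a bilinear map \<open>f\<close> induces.\<close>

definition tensor_lift ::
    "('a::complex_vector \<Rightarrow> 'b::complex_vector \<Rightarrow> 'c::complex_vector) \<Rightarrow> ('a, 'b) tensor \<Rightarrow> 'c"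
  where "tensor_lift f = (THE g. clinear g \<and> (\<forall>a b. g (a \<otimes>\<^sub>C b) = f a b))"


section \<open>The free product of unital complex algebras\<close>

datatype 'g free_monoid = Word "'g list"

instantiation free_monoid :: (type) monoid_add
begin

definition zero_free_monoid :: "'a free_monoid" where
  "0 = Word []"

fun plus_free_monoid :: "'a free_monoid \<Rightarrow> 'a free_monoid \<Rightarrow> 'a free_monoid" where
  "Word u + Word v = Word (u @ v)"

instance
proof
  fix a b c :: "'a free_monoid"
  show "a + b + c = a + (b + c)"
    by (cases a; cases b; cases c) simp
  show "0 + a = a" and "a + 0 = a"
    by (cases a; simp add: zero_free_monoid_def)+
qed

end

text \<open>Finitely supported functions on the free monoid, with convolution as multiplication,
  form the free unital complex algebra.\<close>

type_synonym 'g free_algebra = "'g free_monoid \<Rightarrow>\<^sub>0 complex"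

definition letter :: "'g \<Rightarrow> 'g free_algebra" where
  "letter g = Poly_Mapping.single (Word [g]) 1"

inductive_set ideal_generated :: "'r::ring_1 set \<Rightarrow> 'r set" for S where
  gen: "x \<in> S \<Longrightarrow> x \<in> ideal_generated S"
| zero: "0 \<in> ideal_generated S"
| add: "x \<in> ideal_generated S \<Longrightarrow> y \<in> ideal_generated S \<Longrightarrow> x + y \<in> ideal_generated S"
| mult_left: "x \<in> ideal_generated S \<Longrightarrow> r * x \<in> ideal_generated S"
| mult_right: "x \<in> ideal_generated S \<Longrightarrow> x * r \<in> ideal_generated S"

lemma ideal_generated_uminus:
  assumes "x \<in> ideal_generated S"
  shows "- x \<in> ideal_generated S"
  using ideal_generated.mult_left[OF assms, of "- 1"] by simp

lemma ideal_generated_diff: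
  assumes "x \<in> ideal_generated S" "y \<in> ideal_generated S"
  shows "x - y \<in> ideal_generated S"
  using ideal_generated.add[OF assms(1) ideal_generated_uminus[OF assms(2)]] by simp

text \<open>The relations making \<open>\<lambda>a. letter (i a)\<close> a homomorphism of unital complex algebras.  The
  last of them identifies the units of both factors with the unit of the product, which is the
  amalgamation over the scalars.\<close>

definition algebra_relations :: "('a::complex_algebra_1 \<Rightarrow> 'g) \<Rightarrow> 'g free_algebra set" where
  "algebra_relations i =
     (let e = \<lambda>a. letter (i a) in
       {e (a + a') - e a - e a' | a a'. True} \<union>
       {e (c *\<^sub>C a) - c *\<^sub>C e a | c a. True} \<union>
       {e (a * a') - e a * e a' | a a'. True} \<union>
       {e 1 - 1})"

definition free_product_ideal ::
    "('a::complex_algebra_1 + 'b::complex_algebra_1) free_algebra set" where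
  "free_product_ideal = ideal_generated (algebra_relations Inl \<union> algebra_relations Inr)"

lemmas free_product_ideal_intros =
  ideal_generated.zero[where S = "algebra_relations Inl \<union> algebra_relations Inr",
    folded free_product_ideal_def]
  ideal_generated.add[where S = "algebra_relations Inl \<union> algebra_relations Inr",
    folded free_product_ideal_def]
  ideal_generated_uminus[where S = "algebra_relations Inl \<union> algebra_relations Inr",
    folded free_product_ideal_def]
  ideal_generated_diff[where S = "algebra_relations Inl \<union> algebra_relations Inr",
    folded free_product_ideal_def]
  ideal_generated.mult_left[where S = "algebra_relations Inl \<union> algebra_relations Inr",
    folded free_product_ideal_def]
  ideal_generated.mult_right[where S = "algebra_relations Inl \<union> algebra_relations Inr",
    folded free_product_ideal_def]

quotient_type (overloaded) ('a, 'b) free_product =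
    "('a::complex_algebra_1 + 'b::complex_algebra_1) free_algebra" /
    "\<lambda>p q. p - q \<in> free_product_ideal"
proof (rule equivpI)
  show "reflp (\<lambda>p q :: ('a + 'b) free_algebra. p - q \<in> free_product_ideal)"
    by (rule reflpI) (simp add: free_product_ideal_intros)
  show "symp (\<lambda>p q :: ('a + 'b) free_algebra. p - q \<in> free_product_ideal)"
    by (rule sympI) (metis free_product_ideal_intros(3) minus_diff_eq)
  show "transp (\<lambda>p q :: ('a + 'b) free_algebra. p - q \<in> free_product_ideal)"
    by (rule transpI) (drule (1) free_product_ideal_intros(2), simp)
qed

instantiation free_product :: (complex_algebra_1, complex_algebra_1) complex_algebra_1
begin

lift_definition zero_free_product :: "('a, 'b) free_product" is 0 .

lift_definition one_free_product :: "('a, 'b) free_product" is 1 .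

lift_definition plus_free_product ::
    "('a, 'b) free_product \<Rightarrow> ('a, 'b) free_product \<Rightarrow> ('a, 'b) free_product" is "(+)"
  by (metis add_diff_add free_product_ideal_intros(2))

lift_definition minus_free_product ::
    "('a, 'b) free_product \<Rightarrow> ('a, 'b) free_product \<Rightarrow> ('a, 'b) free_product" is "(-)"
  by (drule (1) free_product_ideal_intros(4)) (simp add: algebra_simps)

lift_definition uminus_free_product ::
    "('a, 'b) free_product \<Rightarrow> ('a, 'b) free_product" is uminus
  by (metis free_product_ideal_intros(3) minus_diff_minus)

lift_definition times_free_product ::
    "('a, 'b) free_product \<Rightarrow> ('a, 'b) free_product \<Rightarrow> ('a, 'b) free_product" is "(*)"
proof -
  fix p p' q q' :: "('a + 'b) free_algebra"
  assume "p - p' \<in> free_product_ideal" "q - q' \<in> free_product_ideal"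
  then have "(p - p') * q + p' * (q - q') \<in> free_product_ideal"
    by (simp add: free_product_ideal_intros)
  then show "p * q - p' * q' \<in> free_product_ideal"
    by (simp add: algebra_simps)
qed

lift_definition scaleC_free_product ::
    "complex \<Rightarrow> ('a, 'b) free_product \<Rightarrow> ('a, 'b) free_product" is scaleC
  by (metis complex_vector.scale_right_diff_distrib free_product_ideal_intros(5)
      scaleC_poly_mapping_eq_mult(1))

instance
proof
  fix a b :: complex and x y z :: "('a, 'b) free_product"
  show "a *\<^sub>C x * y = a *\<^sub>C (x * y)"
    by transfer (simp add: scaleC_poly_mapping_eq_mult(1) mult.assoc free_product_ideal_intros)
  show "x * a *\<^sub>C y = a *\<^sub>C (x * y)"
    by transfer (simp add: scaleC_poly_mapping_eq_mult(2) mult.assoc free_product_ideal_intros)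
qed (transfer; simp add: algebra_simps free_product_ideal_intros scaleC_add_right scaleC_add_left
      scaleC_scaleC scaleC_one)+

end

lift_definition free_product_inl ::
    "'a::complex_algebra_1 \<Rightarrow> ('a, 'b::complex_algebra_1) free_product"
  is "\<lambda>a. letter (Inl a)" .

lift_definition free_product_inr ::
    "'b::complex_algebra_1 \<Rightarrow> ('a::complex_algebra_1, 'b) free_product"
  is "\<lambda>b. letter (Inr b)" .


section \<open>Polynomials over \<open>B\<close> in one noncommuting indeterminate\<close>

type_synonym 'b nc_poly = "('b, complex poly) free_product"

definition nc_const :: "'b::complex_algebra_1 \<Rightarrow> 'b nc_poly" where
  "nc_const b = free_product_inl b"

definition nc_X :: "'b::complex_algebra_1 nc_poly" where
  "nc_X = free_product_inr [:0, 1:]"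

text \<open>\<open>nc_monomial [b\<^sub>0, \<dots>, b\<^sub>n]\<close> is \<open>b\<^sub>0 X b\<^sub>1 X \<dots> X b\<^sub>n\<close>; the value at the empty list is irrelevant.\<close>

fun nc_monomial :: "'b::complex_algebra_1 list \<Rightarrow> 'b nc_poly" where
  "nc_monomial [] = 1"
| "nc_monomial [b] = nc_const b"
| "nc_monomial (b # c # bs) = nc_const b * nc_X * nc_monomial (c # bs)"

text \<open>A derivation takes its values in the bimodule \<open>B\<langle>X\<rangle> \<otimes> B\<langle>X\<rangle>\<close> with
  \<open>p (a \<otimes> b) q = pa \<otimes> bq\<close>.\<close>

definition tensor_act_left ::
    "'a::complex_algebra_1 \<Rightarrow> ('a, 'a) tensor \<Rightarrow> ('a, 'a) tensor" where
  "tensor_act_left p = tensor_lift (\<lambda>a b. (p * a) \<otimes>\<^sub>C b)"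

definition tensor_act_right ::
    "('a, 'a) tensor \<Rightarrow> 'a::complex_algebra_1 \<Rightarrow> ('a, 'a) tensor" where
  "tensor_act_right t q = tensor_lift (\<lambda>a b. a \<otimes>\<^sub>C (b * q)) t"

definition tensor_derivation :: "('a::complex_algebra_1 \<Rightarrow> ('a, 'a) tensor) \<Rightarrow> bool" where
  "tensor_derivation D \<longleftrightarrow>
     clinear D \<and> (\<forall>p q. D (p * q) = tensor_act_right (D p) q + tensor_act_left p (D q))"

definition free_difference_quotient ::
    "'b::complex_algebra_1 nc_poly \<Rightarrow> ('b nc_poly, 'b nc_poly) tensor" where
  "free_difference_quotient =
     (THE D. tensor_derivation D \<and> D nc_X = 1 \<otimes>\<^sub>C 1 \<and> (\<forall>b. D (nc_const b) = 0))"

definition tensor_flip :: "('a::complex_vector, 'b::complex_vector) tensor \<Rightarrow> ('b, 'a) tensor" where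
  "tensor_flip = tensor_lift (\<lambda>p q. q \<otimes>\<^sub>C p)"

definition tensor_mult :: "('a::complex_algebra_1, 'a) tensor \<Rightarrow> 'a" where
  "tensor_mult = tensor_lift (\<lambda>p q. p * q)"

definition cyclic_derivative :: "'b::complex_algebra_1 nc_poly \<Rightarrow> 'b nc_poly" where
  "cyclic_derivative = tensor_mult \<circ> tensor_flip \<circ> free_difference_quotient"

text \<open>\<open>b\<^sub>0 X b\<^sub>1 X \<dots> X b\<^sub>n\<close> is sent to \<open>b\<^sub>1 X \<dots> X b\<^sub>n X b\<^sub>0\<close>, which for \<open>n = 0\<close> is \<open>b\<^sub>0\<close> itself.\<close>

definition cyclic_rotation :: "'b::complex_algebra_1 nc_poly \<Rightarrow> 'b nc_poly" where
  "cyclic_rotation =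
     (THE r. clinear r \<and> (\<forall>bs. bs \<noteq> [] \<longrightarrow> r (nc_monomial bs) = nc_monomial (rotate1 bs)))"

definition nc_Theta :: "'b::complex_algebra_1 nc_poly \<Rightarrow> 'b nc_poly" where
  "nc_Theta p = p - cyclic_rotation p"

definition commutator_span :: "'a::complex_algebra_1 set" where
  "commutator_span = complex_vector.span {p * q - q * p | p q. True}"

definition const_plus_commutators :: "'b::complex_algebra_1 nc_poly set" where
  "const_plus_commutators = {nc_const b + c | b c. c \<in> commutator_span}"


section \<open>Exact sequences\<close>

text \<open>Exactness at the middle term of \<open>f : U \<rightarrow> V\<close> and \<open>g : V \<rightarrow> W\<close>, where \<open>U\<close> and \<open>V\<close> are
  given as subspaces of the ambient types.\<close>

definition exact_at ::
    "'a set \<Rightarrow> ('a \<Rightarrow> 'b) \<Rightarrow> 'b set \<Rightarrow> ('b \<Rightarrow> 'c::zero) \<Rightarrow> bool" where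
  "exact_at U f V g \<longleftrightarrow> f ` U = {y \<in> V. g y = 0}"

end

theory Submission
  imports Defs
begin

text \<open>
  Write \<open>A = B\<langle>X\<rangle>\<close>, \<open>\<partial>\<close> for the free difference quotient, \<open>\<delta>\<close> for the cyclic derivative and \<open>\<rho>\<close>
  for the cyclic rotation, and let \<open>A\<^sub>n\<close> be the span of the monomials \<open>b\<^sub>0 X b\<^sub>1 X \<dots> X b\<^sub>n\<close>.

  The maps \<open>\<partial>\<close> and \<open>\<rho>\<close> are given by their defining properties, so these must be shown to
  characterize them.  Uniqueness holds because the monomials span \<open>A\<close>.  Existence comes from the
  universal property of the free product: \<open>\<partial>\<close> is the second component of a homomorphism from
  \<open>A\<close> to the square-zero extension of \<open>A\<close> by the bimodule \<open>A \<otimes> A\<close>, and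
  \<open>\<rho> p = \<epsilon> p + R (\<partial> p)\<close>, where the homomorphism \<open>\<epsilon> : A \<rightarrow> A\<close> fixes \<open>B\<close> and kills \<open>X\<close>, and where
  \<open>R (a \<otimes> b) = b X \<epsilon> a\<close>: the map \<open>\<epsilon>\<close> keeps of \<open>\<partial>(b\<^sub>0 X \<dots> X b\<^sub>n)\<close> only the term
  \<open>b\<^sub>0 \<otimes> b\<^sub>1 X \<dots> X b\<^sub>n\<close>.  No model of \<open>A\<close> as a direct sum of tensor powers of \<open>B\<close> is needed.

  The argument for exactness rests on the following facts.
  \<^item> \<open>\<delta> (p q)\<close> is symmetric in \<open>p\<close> and \<open>q\<close>, so \<open>\<delta>\<close> vanishes on commutators; it vanishes on \<open>B\<close> as well.
  \<^item> \<open>A = B + A X + [A, A]\<close> (\<open>nc_poly_decomposition\<close>), since a last coefficient can be moved to the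
    front at the cost of a commutator.  Thus \<open>\<delta>\<close> is determined by its values on \<open>A X\<close>.
  \<^item> \<open>\<delta> (v X) = v + \<rho> v + \<dots> + \<rho>\<^sup>n v\<close> for \<open>v \<in> A\<^sub>n\<close> (\<open>cyclic_derivative_homogeneous_X\<close>), and
    \<open>\<rho>\<close> has order dividing \<open>n + 1\<close> on \<open>A\<^sub>n\<close>.
  \<^item> \<open>(v - \<rho> v) X\<close> lies in \<open>[A, A]\<close> (\<open>rotation_difference_X\<close>).
  \<^item> \<open>A\<close> is the direct sum of the \<open>A\<^sub>n\<close>.  They are independent because they are eigenspaces, with
    distinct eigenvalues, of the operator that counts the occurrences of \<open>X\<close>.

  Everything then reduces to one \<open>A\<^sub>n\<close> and the orbit sum \<open>N = 1 + \<rho> + \<dots> + \<rho>\<^sup>n\<close> on it.  If \<open>N v = 0\<close>,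
  then \<open>(n + 1) v\<close> is the sum of the differences \<open>v - \<rho>\<^sup>i v\<close>, so \<open>v X\<close> lies in \<open>[A, A]\<close>; this gives the
  kernel of \<open>\<delta>\<close>.  Orbit sums are fixed by \<open>\<rho>\<close>, and if \<open>\<rho> v = v\<close> then \<open>v = N v / (n + 1)\<close>; this
  gives the kernel of \<open>\<Theta>\<close>.
\<close>

section \<open>Linear maps\<close>

lemma clinearI:
  assumes "\<And>x y. f (x + y) = f x + f y" "\<And>c x. f (c *\<^sub>C x) = c *\<^sub>C f x"
  shows "clinear f"
  by unfold_locales (auto simp: assms)

lemma clinear_add: "clinear f \<Longrightarrow> f (x + y) = f x + f y"
  by (rule module_hom.add[of scaleC scaleC]) (simp add: Vector_Spaces.linear_def)

lemma clinear_scale: "clinear f \<Longrightarrow> f (c *\<^sub>C x) = c *\<^sub>C f x"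
  by (rule module_hom.scale[of scaleC scaleC]) (simp add: Vector_Spaces.linear_def)

lemma clinear_zero: "clinear f \<Longrightarrow> f 0 = 0"
  by (rule module_hom.zero[of scaleC scaleC]) (simp add: Vector_Spaces.linear_def)

lemma clinear_diff: "clinear f \<Longrightarrow> f (x - y) = f x - f y"
  by (rule module_hom.diff[of scaleC scaleC]) (simp add: Vector_Spaces.linear_def)

lemma clinear_sum: "clinear f \<Longrightarrow> f (sum g I) = (\<Sum>i\<in>I. f (g i))"
  by (rule module_hom.sum[of scaleC scaleC]) (simp add: Vector_Spaces.linear_def)

lemma clinear_id: "clinear (\<lambda>x. x)"
  by (rule clinearI) simp_all

lemma clinear_zero_fun: "clinear (\<lambda>x. 0)"
  by (rule clinearI) simp_all

lemma clinear_compose: "clinear f \<Longrightarrow> clinear g \<Longrightarrow> clinear (\<lambda>x. g (f x))"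
  by (rule clinearI) (simp_all add: clinear_add clinear_scale)

lemma clinear_plus: "clinear f \<Longrightarrow> clinear g \<Longrightarrow> clinear (\<lambda>x. f x + g x)"
  by (rule clinearI) (simp_all add: clinear_add clinear_scale scaleC_add_right)

lemma clinear_minus: "clinear f \<Longrightarrow> clinear g \<Longrightarrow> clinear (\<lambda>x. f x - g x)"
  by (rule clinearI)
    (simp_all add: clinear_add clinear_scale complex_vector.scale_right_diff_distrib)

lemma clinear_scale_fun: "clinear f \<Longrightarrow> clinear (\<lambda>x. c *\<^sub>C f x)"
  by (rule clinearI)
    (simp_all add: clinear_add clinear_scale scaleC_add_right scaleC_scaleC mult.commute)

lemma clinear_sum_fun: "(\<And>i. i \<in> I \<Longrightarrow> clinear (f i)) \<Longrightarrow> clinear (\<lambda>x. \<Sum>i\<in>I. f i x)"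
  by (rule clinearI)
    (simp_all add: clinear_add clinear_scale sum.distrib complex_vector.scale_sum_right)

lemma clinear_mult_left: "clinear (\<lambda>x. a * x :: 'a::complex_algebra_1)"
  by (rule clinearI) (simp_all add: distrib_left mult_scaleC_right)

lemma clinear_mult_right: "clinear (\<lambda>x. x * a :: 'a::complex_algebra_1)"
  by (rule clinearI) (simp_all add: distrib_right mult_scaleC_left)

lemma clinear_funpow:
  fixes f :: "'a::complex_vector \<Rightarrow> 'a"
  shows "clinear f \<Longrightarrow> clinear (f ^^ k)"
  by (induction k) (auto simp: o_def id_def intro: clinear_id clinear_compose)

lemma clinear_span_mem:
  assumes f: "clinear f" and W: "complex_vector.subspace W"
    and S: "\<And>x. x \<in> S \<Longrightarrow> f x \<in> W" and x: "x \<in> complex_vector.span S"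
  shows "f x \<in> W"
  using x
proof (induction rule: complex_vector.span_induct_alt)
  case base
  then show ?case by (simp add: clinear_zero[OF f] complex_vector.subspace_0[OF W])
next
  case (step c x y)
  then show ?case
    by (simp add: clinear_add[OF f] clinear_scale[OF f] S complex_vector.subspace_add[OF W]
        complex_vector.subspace_scale[OF W])
qed

lemma clinear_eq_on_span:
  assumes f: "clinear f" and g: "clinear g"
    and S: "\<And>x. x \<in> S \<Longrightarrow> f x = g x" and x: "x \<in> complex_vector.span S"
  shows "f x = g x"
proof -
  have "f x - g x \<in> {0}"
    by (rule clinear_span_mem[OF clinear_minus[OF f g] complex_vector.subspace_single_0 _ x])
      (simp add: S)
  then show ?thesis by simp
qed

text \<open>The complex-valued functions of finite support on \<open>'k\<close> are the free vector space on \<open>'k\<close>;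
  this is the linear map on it that extends \<open>\<phi>\<close> from the basis.\<close>

definition linear_extension ::
    "('k \<Rightarrow> 'v::complex_vector) \<Rightarrow> ('k \<Rightarrow>\<^sub>0 complex) \<Rightarrow> 'v" where
  "linear_extension \<phi> p = (\<Sum>k\<in>Poly_Mapping.keys p. Poly_Mapping.lookup p k *\<^sub>C \<phi> k)"

lemma linear_extension_superset:
  assumes "finite K" "Poly_Mapping.keys p \<subseteq> K"
  shows "linear_extension \<phi> p = (\<Sum>k\<in>K. Poly_Mapping.lookup p k *\<^sub>C \<phi> k)"
  unfolding linear_extension_def using assms
  by (intro sum.mono_neutral_left) (auto simp: in_keys_iff)

lemma clinear_linear_extension: "clinear (linear_extension \<phi>)"
proof (rule clinearI)
  fix p q :: "'a \<Rightarrow>\<^sub>0 complex" and c :: complex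
  let ?K = "Poly_Mapping.keys p \<union> Poly_Mapping.keys q"
  have "Poly_Mapping.keys (p + q) \<subseteq> ?K" by (rule Poly_Mapping.keys_add)
  then show "linear_extension \<phi> (p + q) = linear_extension \<phi> p + linear_extension \<phi> q"
    by (simp add: linear_extension_superset[of ?K] lookup_add scaleC_add_left sum.distrib)
  have "Poly_Mapping.keys (c *\<^sub>C p) \<subseteq> Poly_Mapping.keys p"
    by (auto simp: in_keys_iff scaleC_poly_mapping.rep_eq)
  then show "linear_extension \<phi> (c *\<^sub>C p) = c *\<^sub>C linear_extension \<phi> p"
    by (simp add: linear_extension_superset[of "Poly_Mapping.keys p"] scaleC_poly_mapping.rep_eq
        complex_vector.scale_sum_right scaleC_scaleC)
qed

lemma linear_extension_single: "linear_extension \<phi> (Poly_Mapping.single k c) = c *\<^sub>C \<phi> k"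
  by (cases "c = 0") (simp_all add: linear_extension_def)

lemma span_single: "p \<in> complex_vector.span (range (\<lambda>k. Poly_Mapping.single k (1::complex)))"
proof (induction p rule: update_induct)
  case const
  show ?case by (rule complex_vector.span_zero)
next
  case (update f a b)
  have "Poly_Mapping.single a b = b *\<^sub>C Poly_Mapping.single a (1::complex)"
    by (simp add: scaleC_single)
  then have "Poly_Mapping.single a b
      \<in> complex_vector.span (range (\<lambda>k. Poly_Mapping.single k (1::complex)))"
    by (simp add: complex_vector.span_base complex_vector.span_scale)
  with update show ?case
    by (simp add: update_eq_add_single complex_vector.span_add)
qed


section \<open>Linear maps out of a tensor product\<close>

lemma tensor_relations_mem:
  "Poly_Mapping.single (a + a', b) 1 - Poly_Mapping.single (a, b) 1 - Poly_Mapping.single (a', b) 1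
    \<in> tensor_relations"
  "Poly_Mapping.single (a, b + b') 1 - Poly_Mapping.single (a, b) 1 - Poly_Mapping.single (a, b') 1
    \<in> tensor_relations"
  "Poly_Mapping.single (c *\<^sub>C a, b) 1 - c *\<^sub>C Poly_Mapping.single (a, b) 1 \<in> tensor_relations"
  "Poly_Mapping.single (a, c *\<^sub>C b) 1 - c *\<^sub>C Poly_Mapping.single (a, b) 1 \<in> tensor_relations"
  unfolding tensor_relations_def Let_def by blast+

lemma pure_tensor_add_left: "(a + a') \<otimes>\<^sub>C b = a \<otimes>\<^sub>C b + a' \<otimes>\<^sub>C b"
  by transfer
    (rule complex_vector.span_base, unfold diff_diff_eq[symmetric], rule tensor_relations_mem)

lemma pure_tensor_add_right: "a \<otimes>\<^sub>C (b + b') = a \<otimes>\<^sub>C b + a \<otimes>\<^sub>C b'"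
  by transfer
    (rule complex_vector.span_base, unfold diff_diff_eq[symmetric], rule tensor_relations_mem)

lemma pure_tensor_scale_left: "(c *\<^sub>C a) \<otimes>\<^sub>C b = c *\<^sub>C (a \<otimes>\<^sub>C b)"
  by transfer (rule complex_vector.span_base, rule tensor_relations_mem)

lemma pure_tensor_scale_right: "a \<otimes>\<^sub>C (c *\<^sub>C b) = c *\<^sub>C (a \<otimes>\<^sub>C b)"
  by transfer (rule complex_vector.span_base, rule tensor_relations_mem)

lemma clinear_abs_tensor: "clinear abs_tensor"
  by (rule clinearI) (simp_all add: plus_tensor.abs_eq scaleC_tensor.abs_eq)

lemma span_pure_tensor: "t \<in> complex_vector.span {a \<otimes>\<^sub>C b | a b. True}"
proof (induction t rule: tensor.abs_induct)
  case (1 p)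
  show ?case
    by (rule clinear_span_mem[OF clinear_abs_tensor complex_vector.subspace_span _ span_single])
      (force simp: pure_tensor.abs_eq intro: complex_vector.span_base)
qed

lemma clinear_tensor_eqI:
  assumes "clinear f" "clinear g" "\<And>a b. f (a \<otimes>\<^sub>C b) = g (a \<otimes>\<^sub>C b)"
  shows "f t = g t"
  by (rule clinear_eq_on_span[OF assms(1,2) _ span_pure_tensor]) (auto simp: assms(3))

text \<open>For a bilinear map \<open>f\<close>, \<^const>\<open>tensor_lift\<close> \<open>f\<close> has the properties that its
  definition by description asks for.\<close>

locale bilinear_map =
  fixes f :: "'a::complex_vector \<Rightarrow> 'b::complex_vector \<Rightarrow> 'c::complex_vector"
  assumes clinear_left: "clinear (\<lambda>a. f a b)"
    and clinear_right: "clinear (\<lambda>b. f a b)"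
begin

lemma tensor_lift_unique: "\<exists>!g. clinear g \<and> (\<forall>a b. g (a \<otimes>\<^sub>C b) = f a b)"
proof (rule ex_ex1I)
  let ?h = "linear_extension (\<lambda>(a, b). f a b)"
  note h = clinear_linear_extension[of "\<lambda>(a, b). f a b"]
  have "?h r \<in> {0}" if "r \<in> complex_vector.span tensor_relations" for r
    by (rule clinear_span_mem[OF h complex_vector.subspace_single_0 _ that])
      (auto simp: tensor_relations_def Let_def clinear_add[OF h] clinear_diff[OF h]
        clinear_scale[OF h] linear_extension_single scaleC_one
        clinear_add[OF clinear_left] clinear_add[OF clinear_right]
        clinear_scale[OF clinear_left] clinear_scale[OF clinear_right])
  then have h_eq: "?h p = ?h q" if "p - q \<in> complex_vector.span tensor_relations" for p q
    using that clinear_diff[OF h, of p q] by simp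
  have h_abs: "?h (rep_tensor (abs_tensor p)) = ?h p" for p
    by (rule h_eq) (rule Quotient_rep_abs[OF Quotient_tensor], simp add: complex_vector.span_zero)
  have "clinear (\<lambda>t. ?h (rep_tensor t))"
  proof (rule clinearI)
    show "?h (rep_tensor (s + t)) = ?h (rep_tensor s) + ?h (rep_tensor t)" for s t
      by (induct s rule: tensor.abs_induct, induct t rule: tensor.abs_induct)
        (simp add: plus_tensor.abs_eq h_abs clinear_add[OF h])
    show "?h (rep_tensor (c *\<^sub>C t)) = c *\<^sub>C ?h (rep_tensor t)" for c t
      by (induct t rule: tensor.abs_induct)
        (simp add: scaleC_tensor.abs_eq h_abs clinear_scale[OF h])
  qed
  moreover have "?h (rep_tensor (a \<otimes>\<^sub>C b)) = f a b" for a b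
    by (simp add: pure_tensor.abs_eq h_abs linear_extension_single scaleC_one)
  ultimately show "\<exists>g. clinear g \<and> (\<forall>a b. g (a \<otimes>\<^sub>C b) = f a b)"
    by blast
next
  fix g g'
  assume "clinear g \<and> (\<forall>a b. g (a \<otimes>\<^sub>C b) = f a b)" "clinear g' \<and> (\<forall>a b. g' (a \<otimes>\<^sub>C b) = f a b)"
  then show "g = g'" by - (rule ext, rule clinear_tensor_eqI[of g g'], auto)
qed

lemma clinear_tensor_lift: "clinear (tensor_lift f)"
  and tensor_lift_pure: "tensor_lift f (a \<otimes>\<^sub>C b) = f a b"
  using theI'[OF tensor_lift_unique] unfolding tensor_lift_def[symmetric] by auto

end

lemma bilinear_mapI:
  assumes "\<And>a a' b. f (a + a') b = f a b + f a' b" "\<And>a b b'. f a (b + b') = f a b + f a b'"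
    and "\<And>c a b. f (c *\<^sub>C a) b = c *\<^sub>C f a b" "\<And>c a b. f a (c *\<^sub>C b) = c *\<^sub>C f a b"
  shows "bilinear_map f"
  by unfold_locales (simp_all add: assms)

lemmas bilinear_simps =
  distrib_left distrib_right mult_scaleC_left mult_scaleC_right
  pure_tensor_add_left pure_tensor_add_right pure_tensor_scale_left pure_tensor_scale_right

lemma bilinear_act_left:
  "bilinear_map (\<lambda>(a::'a::complex_algebra_1) (b::'a). (p * a) \<otimes>\<^sub>C b)"
  by (rule bilinear_mapI; simp add: bilinear_simps)

lemma bilinear_act_right:
  "bilinear_map (\<lambda>(a::'a::complex_algebra_1) (b::'a). a \<otimes>\<^sub>C (b * p))"
  by (rule bilinear_mapI; simp add: bilinear_simps)

lemma bilinear_flip: "bilinear_map (\<lambda>a b. b \<otimes>\<^sub>C a)"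
  by (rule bilinear_mapI; simp add: bilinear_simps)

lemma bilinear_mult:
  "bilinear_map (\<lambda>(a::'a::complex_algebra_1) (b::'a). a * b)"
  by (rule bilinear_mapI; simp add: bilinear_simps)

lemma bilinear_reversed_insert:
  "bilinear_map (\<lambda>(a::'a::complex_algebra_1) (b::'a). b * p * a)"
  by (rule bilinear_mapI; simp add: bilinear_simps)

lemma bilinear_insert:
  "bilinear_map (\<lambda>(a::'a::complex_algebra_1) (b::'a). a * p * b)"
  by (rule bilinear_mapI; simp add: bilinear_simps)

lemma clinear_act_left: "clinear (tensor_act_left p)"
  and act_left_pure: "tensor_act_left p (a \<otimes>\<^sub>C b) = (p * a) \<otimes>\<^sub>C b"
  unfolding tensor_act_left_def
  using bilinear_map.clinear_tensor_lift[OF bilinear_act_left]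
    bilinear_map.tensor_lift_pure[OF bilinear_act_left] by auto

lemma clinear_act_right: "clinear (\<lambda>t. tensor_act_right t p)"
  and act_right_pure: "tensor_act_right (a \<otimes>\<^sub>C b) p = a \<otimes>\<^sub>C (b * p)"
  unfolding tensor_act_right_def
  using bilinear_map.clinear_tensor_lift[OF bilinear_act_right]
    bilinear_map.tensor_lift_pure[OF bilinear_act_right] by auto

lemma act_left_mult: "tensor_act_left (p * q) t = tensor_act_left p (tensor_act_left q t)"
  by (rule clinear_tensor_eqI[of "tensor_act_left (p * q)"])
    (simp_all add: clinear_act_left clinear_compose[OF clinear_act_left clinear_act_left]
      act_left_pure mult.assoc)

lemma act_right_mult: "tensor_act_right t (p * q) = tensor_act_right (tensor_act_right t p) q"
  by (rule clinear_tensor_eqI[of "\<lambda>t. tensor_act_right t (p * q)"])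
    (simp_all add: clinear_act_right clinear_compose[OF clinear_act_right clinear_act_right]
      act_right_pure mult.assoc)

lemma act_left_right:
  "tensor_act_left p (tensor_act_right t q) = tensor_act_right (tensor_act_left p t) q"
  by (rule clinear_tensor_eqI[of "\<lambda>t. tensor_act_left p (tensor_act_right t q)"])
    (simp_all add: clinear_compose[OF clinear_act_left clinear_act_right]
      clinear_compose[OF clinear_act_right clinear_act_left] act_right_pure act_left_pure)

lemma act_left_one: "tensor_act_left 1 t = t"
  by (rule clinear_tensor_eqI[OF clinear_act_left clinear_id]) (simp add: act_left_pure)

lemma act_right_one: "tensor_act_right t 1 = t"
  by (rule clinear_tensor_eqI[OF clinear_act_right clinear_id]) (simp add: act_right_pure)

lemma act_left_plus: "tensor_act_left (p + q) t = tensor_act_left p t + tensor_act_left q t"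
  by (rule clinear_tensor_eqI[OF clinear_act_left clinear_plus[OF clinear_act_left clinear_act_left]])
    (simp add: act_left_pure bilinear_simps)

lemma act_right_plus: "tensor_act_right t (p + q) = tensor_act_right t p + tensor_act_right t q"
  by (rule clinear_tensor_eqI[OF clinear_act_right clinear_plus[OF clinear_act_right clinear_act_right]])
    (simp add: act_right_pure bilinear_simps)

lemma act_left_scale: "tensor_act_left (c *\<^sub>C p) t = c *\<^sub>C tensor_act_left p t"
  by (rule clinear_tensor_eqI[OF clinear_act_left clinear_scale_fun[OF clinear_act_left]])
    (simp add: act_left_pure bilinear_simps)

lemma act_right_scale: "tensor_act_right t (c *\<^sub>C p) = c *\<^sub>C tensor_act_right t p"
  by (rule clinear_tensor_eqI[OF clinear_act_right clinear_scale_fun[OF clinear_act_right]])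
    (simp add: act_right_pure bilinear_simps)


section \<open>The universal property of the free product\<close>

text \<open>Homomorphisms of unital complex algebras.\<close>

definition algebra_hom :: "('a::complex_algebra_1 \<Rightarrow> 'b::complex_algebra_1) \<Rightarrow> bool" where
  "algebra_hom f \<longleftrightarrow> clinear f \<and> (\<forall>x y. f (x * y) = f x * f y) \<and> f 1 = 1"

text \<open>The value of a word when each letter \<open>g\<close> is replaced by \<open>\<phi> g\<close>.  Its linear extension is
  the homomorphism from the free algebra that \<open>\<phi>\<close> induces.\<close>

definition word_eval :: "('g \<Rightarrow> 'r::complex_algebra_1) \<Rightarrow> 'g free_monoid \<Rightarrow> 'r" where
  "word_eval \<phi> w = (case w of Word u \<Rightarrow> prod_list (map \<phi> u))"

lemma word_eval_add: "word_eval \<phi> (v + w) = word_eval \<phi> v * word_eval \<phi> w"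
  by (cases v; cases w) (simp add: word_eval_def)

lemma clinear_free_mult_left: "clinear (\<lambda>x. a * x :: 'g free_algebra)"
  by (rule clinearI)
    (simp_all add: distrib_left scaleC_poly_mapping_eq_mult(2) mult.assoc)

lemma clinear_free_mult_right: "clinear (\<lambda>x. x * a :: 'g free_algebra)"
  by (rule clinearI)
    (simp_all add: distrib_right scaleC_poly_mapping_eq_mult(1) mult.assoc)

lemma free_algebra_eval_mult:
  fixes \<phi> :: "'g \<Rightarrow> 'r::complex_algebra_1"
  defines "h \<equiv> linear_extension (word_eval \<phi>)"
  shows "h (p * q) = h p * h q"
proof -
  note h = clinear_linear_extension[of "word_eval \<phi>", folded h_def]
  have single: "h (Poly_Mapping.single v 1 * Poly_Mapping.single w 1)
      = h (Poly_Mapping.single v 1) * h (Poly_Mapping.single w 1)" for v w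
    by (simp add: mult_single h_def linear_extension_single scaleC_one word_eval_add)
  have "h (Poly_Mapping.single v 1 * q) = h (Poly_Mapping.single v 1) * h q" for v
    by (rule clinear_eq_on_span[OF clinear_compose[OF clinear_free_mult_left h]
          clinear_compose[OF h clinear_mult_left] _ span_single]) (auto simp: single)
  then show ?thesis
    by - (rule clinear_eq_on_span[OF clinear_compose[OF clinear_free_mult_right h]
          clinear_compose[OF h clinear_mult_right] _ span_single], auto)
qed

lemma free_algebra_eval_letter:
  "linear_extension (word_eval \<phi>) (letter g) = \<phi> g"
  by (simp add: letter_def linear_extension_single scaleC_one word_eval_def)

lemma free_algebra_eval_one:
  "linear_extension (word_eval \<phi>) 1 = 1"
  by (simp add: linear_extension_single scaleC_one word_eval_def zero_free_monoid_def
      flip: single_one)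

lemma free_algebra_eval_relations:
  assumes "algebra_hom (\<lambda>a. \<phi> (i a))" "r \<in> algebra_relations i"
  shows "linear_extension (word_eval \<phi>) r = 0"
proof -
  note h = clinear_linear_extension[of "word_eval \<phi>"]
  have "clinear (\<lambda>a. \<phi> (i a))" and "\<And>a b. \<phi> (i (a * b)) = \<phi> (i a) * \<phi> (i b)"
    and "\<phi> (i 1) = 1"
    using assms(1) by (auto simp: algebra_hom_def)
  with assms(2) show ?thesis
    by (auto simp: algebra_relations_def Let_def clinear_add[OF h] clinear_diff[OF h]
        clinear_scale[OF h] free_algebra_eval_letter free_algebra_eval_mult free_algebra_eval_one
        clinear_add[of "\<lambda>a. \<phi> (i a)"] clinear_scale[of "\<lambda>a. \<phi> (i a)"])
qed

lemma free_product_universal: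
  fixes f :: "'a::complex_algebra_1 \<Rightarrow> 'r::complex_algebra_1"
    and g :: "'b::complex_algebra_1 \<Rightarrow> 'r"
  assumes "algebra_hom f" "algebra_hom g"
  obtains h :: "('a, 'b) free_product \<Rightarrow> 'r"
    where "algebra_hom h" "\<And>a. h (free_product_inl a) = f a" "\<And>b. h (free_product_inr b) = g b"
proof -
  let ?h = "linear_extension (word_eval (case_sum f g))"
  note h = clinear_linear_extension[of "word_eval (case_sum f g)"]
  have "?h r = 0" if "r \<in> free_product_ideal" for r
    using that unfolding free_product_ideal_def
  proof induction
    case (gen r)
    then show ?case
      using assms free_algebra_eval_relations[of "case_sum f g" Inl r]
        free_algebra_eval_relations[of "case_sum f g" Inr r] by auto
  qed (simp_all add: clinear_zero[OF h] clinear_add[OF h] free_algebra_eval_mult)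
  then have h_eq: "?h p = ?h q" if "p - q \<in> free_product_ideal" for p q
    using that by (metis clinear_diff[OF h] eq_iff_diff_eq_0)
  have h_abs: "?h (rep_free_product (abs_free_product p)) = ?h p" for p
    by (rule h_eq) (rule Quotient_rep_abs[OF Quotient_free_product],
        simp add: free_product_ideal_intros)
  let ?k = "\<lambda>x. ?h (rep_free_product x)"
  have "algebra_hom ?k"
    unfolding algebra_hom_def
  proof (intro conjI allI clinearI)
    show "?k (x + y) = ?k x + ?k y" for x y
      by (induct x rule: free_product.abs_induct, induct y rule: free_product.abs_induct)
        (simp add: plus_free_product.abs_eq h_abs clinear_add[OF h])
    show "?k (c *\<^sub>C x) = c *\<^sub>C ?k x" for c x
      by (induct x rule: free_product.abs_induct)
        (simp add: scaleC_free_product.abs_eq h_abs clinear_scale[OF h])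
    show "?k (x * y) = ?k x * ?k y" for x y
      by (induct x rule: free_product.abs_induct, induct y rule: free_product.abs_induct)
        (simp add: times_free_product.abs_eq h_abs free_algebra_eval_mult)
    show "?k 1 = 1"
      by (simp add: one_free_product.abs_eq h_abs free_algebra_eval_one)
  qed
  moreover have "?k (free_product_inl a) = f a" "?k (free_product_inr b) = g b" for a b
    by (simp_all add: free_product_inl.abs_eq free_product_inr.abs_eq h_abs free_algebra_eval_letter)
  ultimately show thesis by (rule that)
qed

lemma algebra_hom_inl:
  "algebra_hom (free_product_inl :: 'a::complex_algebra_1 \<Rightarrow> ('a, 'b::complex_algebra_1) free_product)"
  unfolding algebra_hom_def
proof (intro conjI allI clinearI; transfer)
  show "letter (Inl (x + y)) - (letter (Inl x) + letter (Inl y)) \<in> free_product_ideal"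
    "letter (Inl (c *\<^sub>C x)) - c *\<^sub>C letter (Inl x) \<in> free_product_ideal"
    "letter (Inl (x * y)) - letter (Inl x) * letter (Inl y) \<in> free_product_ideal"
    "letter (Inl 1) - 1 \<in> free_product_ideal"
    for x y :: 'a and c
    by (auto simp: free_product_ideal_def algebra_relations_def Let_def diff_diff_eq[symmetric]
        intro!: ideal_generated.gen)
qed

lemma algebra_hom_inr:
  "algebra_hom (free_product_inr :: 'b::complex_algebra_1 \<Rightarrow> ('a::complex_algebra_1, 'b) free_product)"
  unfolding algebra_hom_def
proof (intro conjI allI clinearI; transfer)
  show "letter (Inr (x + y)) - (letter (Inr x) + letter (Inr y)) \<in> free_product_ideal"
    "letter (Inr (c *\<^sub>C x)) - c *\<^sub>C letter (Inr x) \<in> free_product_ideal"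
    "letter (Inr (x * y)) - letter (Inr x) * letter (Inr y) \<in> free_product_ideal"
    "letter (Inr 1) - 1 \<in> free_product_ideal"
    for x y :: 'b and c
    by (auto simp: free_product_ideal_def algebra_relations_def Let_def diff_diff_eq[symmetric]
        intro!: ideal_generated.gen)
qed

text \<open>The free product is generated by its two factors: it has no proper subspace that contains
  \<open>1\<close> and is stable under left multiplication by the elements of the factors.\<close>

lemma free_product_induct:
  assumes W: "complex_vector.subspace W" and one: "1 \<in> W"
    and inl: "\<And>a x. x \<in> W \<Longrightarrow> free_product_inl a * x \<in> W"
    and inr: "\<And>b x. x \<in> W \<Longrightarrow> free_product_inr b * x \<in> W"
  shows "x \<in> W"
proof (induction x rule: free_product.abs_induct)
  case (1 p)
  have abs: "clinear abs_free_product"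
    by (rule clinearI) (simp_all add: plus_free_product.abs_eq scaleC_free_product.abs_eq)
  have "abs_free_product (Poly_Mapping.single (Word u) 1) \<in> W" for u
  proof (induction u)
    case Nil
    then show ?case
      using one by (simp add: one_free_product.abs_eq flip: zero_free_monoid_def)
  next
    case (Cons g u)
    have "Poly_Mapping.single (Word (g # u)) 1 = letter g * Poly_Mapping.single (Word u) 1"
      by (simp add: letter_def mult_single)
    then have "abs_free_product (Poly_Mapping.single (Word (g # u)) 1)
        = abs_free_product (letter g) * abs_free_product (Poly_Mapping.single (Word u) 1)"
      by (simp add: times_free_product.abs_eq)
    then show ?case
      using inl[OF Cons] inr[OF Cons]
      by (cases g) (simp_all add: free_product_inl.abs_eq free_product_inr.abs_eq)
  qed
  then show ?case
    by - (rule clinear_span_mem[OF abs W _ span_single], metis free_monoid.exhaust rangeE)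
qed

text \<open>Evaluation of a complex polynomial at an element of a possibly noncommutative algebra, by
  Horner's scheme.\<close>

definition poly_eval :: "'r::complex_algebra_1 \<Rightarrow> complex poly \<Rightarrow> 'r" where
  "poly_eval x p = fold_coeffs (\<lambda>a r. a *\<^sub>C 1 + x * r) p 0"

lemma poly_eval_0 [simp]: "poly_eval x 0 = 0"
  by (simp add: poly_eval_def)

lemma poly_eval_pCons [simp]: "poly_eval x (pCons a p) = a *\<^sub>C 1 + x * poly_eval x p"
  by (cases "p = 0 \<and> a = 0") (auto simp: poly_eval_def)

lemma algebra_hom_poly_eval: "algebra_hom (poly_eval x)"
proof -
  have add: "poly_eval x (p + q) = poly_eval x p + poly_eval x q" for p q
    by (induction p q rule: poly_induct2) (simp_all add: scaleC_add_left distrib_left)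
  have scale: "poly_eval x (smult c p) = c *\<^sub>C poly_eval x p" for c p
    by (induction p) (simp_all add: scaleC_add_right scaleC_scaleC mult_scaleC_right)
  have "poly_eval x (p * q) = poly_eval x p * poly_eval x q" for p q
    by (induction p) (simp_all add: add scale distrib_right mult_scaleC_left mult.assoc)
  with add scale show ?thesis
    unfolding algebra_hom_def
    by (intro conjI clinearI) (simp_all add: scaleC_complex_poly one_pCons scaleC_one)
qed

lemma nc_poly_universal:
  fixes f :: "'b::complex_algebra_1 \<Rightarrow> 'r::complex_algebra_1"
  assumes "algebra_hom f"
  obtains h :: "'b nc_poly \<Rightarrow> 'r"
    where "algebra_hom h" "\<And>b. h (nc_const b) = f b" "h nc_X = x"
proof -
  obtain h :: "'b nc_poly \<Rightarrow> 'r" where "algebra_hom h"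
      "\<And>a. h (free_product_inl a) = f a" "\<And>b. h (free_product_inr b) = poly_eval x b"
    using free_product_universal[OF assms algebra_hom_poly_eval] by metis
  then show thesis
    by (intro that[of h]) (simp_all add: nc_const_def nc_X_def scaleC_one)
qed


lemma algebra_hom_nc_const: "algebra_hom nc_const"
  using algebra_hom_inl by (simp add: nc_const_def[abs_def])


section \<open>Monomials\<close>

lemma nc_monomial_Cons:
  "bs \<noteq> [] \<Longrightarrow> nc_monomial (b # bs) = nc_const b * nc_X * nc_monomial bs"
  by (cases bs) simp_all

lemma nc_monomial_append:
  "us \<noteq> [] \<Longrightarrow> vs \<noteq> [] \<Longrightarrow> nc_monomial (us @ vs) = nc_monomial us * nc_X * nc_monomial vs"
proof (induction us)
  case (Cons u us)
  then show ?case
    by (cases "us = []") (simp_all add: nc_monomial_Cons mult.assoc)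
qed simp

lemma nc_const_one: "nc_const 1 = 1"
  using algebra_hom_nc_const unfolding algebra_hom_def by blast

lemma nc_const_mult: "nc_const (a * b) = nc_const a * nc_const b"
  using algebra_hom_nc_const unfolding algebra_hom_def by blast

lemma clinear_nc_const: "clinear nc_const"
  using algebra_hom_nc_const unfolding algebra_hom_def by blast

lemma span_nc_monomial: "p \<in> complex_vector.span {nc_monomial bs | bs. bs \<noteq> []}"
  (is "_ \<in> complex_vector.span ?S")
proof (rule free_product_induct[where W = "complex_vector.span ?S"])
  show "complex_vector.subspace (complex_vector.span ?S)" by (rule complex_vector.subspace_span)
  have mem: "nc_monomial bs \<in> complex_vector.span ?S" if "bs \<noteq> []" for bs
    using that by (intro complex_vector.span_base) blast
  show "1 \<in> complex_vector.span ?S"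
    using mem[of "[1]"] by (simp add: nc_const_one)
  have const: "nc_const b * x \<in> complex_vector.span ?S" if "x \<in> complex_vector.span ?S" for b x
  proof (rule clinear_span_mem[OF clinear_mult_left complex_vector.subspace_span _ that])
    fix y assume "y \<in> ?S"
    then obtain c cs where "y = nc_monomial (c # cs)" by (auto simp: neq_Nil_conv)
    then have "nc_const b * y = nc_monomial ((b * c) # cs)"
      by (cases "cs = []") (simp_all add: nc_monomial_Cons nc_const_mult mult.assoc)
    then show "nc_const b * y \<in> complex_vector.span ?S" using mem by simp
  qed
  then show "free_product_inl b * x \<in> complex_vector.span ?S"
    if "x \<in> complex_vector.span ?S" for b x
    using that by (simp add: nc_const_def)
  have X: "nc_X * x \<in> complex_vector.span ?S" if "x \<in> complex_vector.span ?S" for x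
  proof (rule clinear_span_mem[OF clinear_mult_left complex_vector.subspace_span _ that])
    fix y assume "y \<in> ?S"
    then obtain bs where "bs \<noteq> []" "y = nc_monomial bs" by auto
    then have "nc_X * y = nc_monomial (1 # bs)"
      by (simp add: nc_monomial_Cons nc_const_one)
    then show "nc_X * y \<in> complex_vector.span ?S" using mem by simp
  qed
  show "free_product_inr f * x \<in> complex_vector.span ?S"
    if x: "x \<in> complex_vector.span ?S" for f x
  proof (induction f)
    case 0
    have "free_product_inr 0 = (0 :: 'a nc_poly)"
      using algebra_hom_inr by (auto simp: algebra_hom_def intro: clinear_zero)
    then show ?case by (simp add: complex_vector.span_zero)
  next
    case (pCons a f)
    have inr: "clinear free_product_inr"
      "free_product_inr (p * q) = free_product_inr p * free_product_inr q"
      "free_product_inr 1 = (1 :: 'a nc_poly)" for p q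
      using algebra_hom_inr by (auto simp: algebra_hom_def)
    have "pCons a f = a *\<^sub>C 1 + [:0, 1:] * f"
      by (simp add: scaleC_complex_poly)
    then have "free_product_inr (pCons a f) * x
        = a *\<^sub>C x + nc_X * (free_product_inr f * x)"
      by (simp add: clinear_add[OF inr(1)] clinear_scale[OF inr(1)] inr distrib_right
          mult_scaleC_left nc_X_def mult.assoc del: mult_pCons_left)
    then show ?case
      using x X[OF pCons.IH] by (simp add: complex_vector.span_add complex_vector.span_scale)
  qed
qed

lemma clinear_nc_poly_eqI:
  assumes "clinear f" "clinear g" "\<And>bs. bs \<noteq> [] \<Longrightarrow> f (nc_monomial bs) = g (nc_monomial bs)"
  shows "f p = g p"
  by (rule clinear_eq_on_span[OF assms(1,2) _ span_nc_monomial]) (auto simp: assms(3))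

lemma clinear_nc_poly_mem:
  assumes "clinear f" "complex_vector.subspace W" "\<And>bs. bs \<noteq> [] \<Longrightarrow> f (nc_monomial bs) \<in> W"
  shows "f p \<in> W"
  by (rule clinear_span_mem[OF assms(1,2) _ span_nc_monomial]) (auto simp: assms(3))


section \<open>The free difference quotient\<close>

text \<open>The square-zero extension of \<open>A\<close> by the bimodule \<open>A \<otimes> A\<close>: the product of \<open>(a, s)\<close> and
  \<open>(b, t)\<close> is \<open>(a b, s b + a t)\<close>.  A linear map \<open>D\<close> is a derivation if and only if \<open>p \<mapsto> (p, D p)\<close>
  is multiplicative.\<close>

typedef (overloaded) 'a square_zero = "UNIV :: ('a::complex_algebra_1 \<times> ('a, 'a) tensor) set"
  by simp

text \<open>Tensors are components of the elements here and are not to be unfolded into their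
  representatives.\<close>

lifting_forget tensor.lifting
setup_lifting type_definition_square_zero

lemmas act_left_linear = clinear_add[OF clinear_act_left] clinear_scale[OF clinear_act_left]
  clinear_zero[OF clinear_act_left]

lemmas act_right_linear = clinear_add[OF clinear_act_right] clinear_scale[OF clinear_act_right]
  clinear_zero[OF clinear_act_right]

instantiation square_zero :: (complex_algebra_1) complex_algebra_1
begin

lift_definition zero_square_zero :: "'a square_zero" is "(0, 0)" .

lift_definition one_square_zero :: "'a square_zero" is "(1, 0)" .

lift_definition plus_square_zero :: "'a square_zero \<Rightarrow> 'a square_zero \<Rightarrow> 'a square_zero"
  is "\<lambda>(a, s) (b, t). (a + b, s + t)" .

lift_definition minus_square_zero :: "'a square_zero \<Rightarrow> 'a square_zero \<Rightarrow> 'a square_zero"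
  is "\<lambda>(a, s) (b, t). (a - b, s - t)" .

lift_definition uminus_square_zero :: "'a square_zero \<Rightarrow> 'a square_zero"
  is "\<lambda>(a, s). (- a, - s)" .

lift_definition scaleC_square_zero :: "complex \<Rightarrow> 'a square_zero \<Rightarrow> 'a square_zero"
  is "\<lambda>c (a, s). (c *\<^sub>C a, c *\<^sub>C s)" .

lift_definition times_square_zero :: "'a square_zero \<Rightarrow> 'a square_zero \<Rightarrow> 'a square_zero"
  is "\<lambda>(a, s) (b, t). (a * b, tensor_act_right s b + tensor_act_left a t)" .

instance
  by (standard; transfer)
    (auto simp: algebra_simps scaleC_add_right scaleC_add_left scaleC_scaleC scaleC_one
      mult_scaleC_left mult_scaleC_right act_left_linear act_right_linear act_left_one act_right_one
      act_left_plus act_right_plus act_left_scale act_right_scale act_left_mult act_right_mult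
      act_left_right)

end

lift_definition square_zero_base :: "'a::complex_algebra_1 square_zero \<Rightarrow> 'a" is fst .

lift_definition square_zero_tensor :: "'a::complex_algebra_1 square_zero \<Rightarrow> ('a, 'a) tensor" is snd .

lift_definition square_zero_pair ::
  "'a::complex_algebra_1 \<Rightarrow> ('a, 'a) tensor \<Rightarrow> 'a square_zero" is Pair .

lemma algebra_hom_square_zero_base: "algebra_hom square_zero_base"
  unfolding algebra_hom_def by (intro conjI allI clinearI; transfer) auto

lemma clinear_square_zero_tensor: "clinear square_zero_tensor"
  by (intro clinearI; transfer) auto

lemma square_zero_tensor_mult:
  "square_zero_tensor (x * y) = tensor_act_right (square_zero_tensor x) (square_zero_base y)
    + tensor_act_left (square_zero_base x) (square_zero_tensor y)"
  by transfer auto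

lemma square_zero_pair_simps [simp]:
  "square_zero_base (square_zero_pair a t) = a"
  "square_zero_tensor (square_zero_pair a t) = t"
  by (transfer; simp)+

lemma algebra_hom_square_zero_pair: "algebra_hom (\<lambda>a. square_zero_pair a 0)"
  unfolding algebra_hom_def
  by (intro conjI allI clinearI; transfer) (auto simp: act_left_linear act_right_linear)

lemma algebra_hom_compose: "algebra_hom f \<Longrightarrow> algebra_hom g \<Longrightarrow> algebra_hom (\<lambda>x. g (f x))"
  by (auto simp: algebra_hom_def intro: clinear_compose)

text \<open>In \<open>tensor_derivation_exists\<close> this shows that the first component of the homomorphism into
  the square-zero extension is the identity.\<close>

lemma algebra_hom_nc_poly_eq_id:
  assumes h: "algebra_hom h"
    and hc: "\<And>b. h (nc_const b) = nc_const b" and hX: "h nc_X = nc_X"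
  shows "h p = p"
proof (rule clinear_nc_poly_eqI[OF _ clinear_id])
  show "clinear h" using h by (simp add: algebra_hom_def)
  have mult: "h (x * y) = h x * h y" for x y using h by (simp add: algebra_hom_def)
  show "h (nc_monomial bs) = nc_monomial bs" if "bs \<noteq> []" for bs
    using that by (induction bs rule: nc_monomial.induct) (simp_all add: hc hX mult)
qed

lemma tensor_derivation_exists:
  obtains D :: "'b::complex_algebra_1 nc_poly \<Rightarrow> ('b nc_poly, 'b nc_poly) tensor"
  where "tensor_derivation D" "D nc_X = 1 \<otimes>\<^sub>C 1" "\<And>b. D (nc_const b) = 0"
proof -
  obtain h :: "'b nc_poly \<Rightarrow> 'b nc_poly square_zero" where h: "algebra_hom h"
    and hc: "\<And>b. h (nc_const b) = square_zero_pair (nc_const b) 0"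
    and hX: "h nc_X = square_zero_pair nc_X (1 \<otimes>\<^sub>C 1)"
    using nc_poly_universal[OF algebra_hom_compose[OF algebra_hom_nc_const
          algebra_hom_square_zero_pair]] by metis
  have base: "square_zero_base (h p) = p" for p
    by (rule algebra_hom_nc_poly_eq_id[OF algebra_hom_compose[OF h algebra_hom_square_zero_base]])
      (simp_all add: hc hX)
  have "tensor_derivation (\<lambda>p. square_zero_tensor (h p))"
    using h by (simp add: tensor_derivation_def algebra_hom_def square_zero_tensor_mult base
        clinear_compose[OF _ clinear_square_zero_tensor])
  then show thesis
    by (rule that) (simp_all add: hc hX)
qed

lemma tensor_derivation_monomial:
  assumes D: "tensor_derivation D" and DX: "D nc_X = 1 \<otimes>\<^sub>C 1" and Dc: "\<And>b. D (nc_const b) = 0"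
    and "bs \<noteq> []"
  shows "D (nc_monomial bs)
    = (\<Sum>i\<in>{1..<length bs}. nc_monomial (take i bs) \<otimes>\<^sub>C nc_monomial (drop i bs))"
  using \<open>bs \<noteq> []\<close>
proof (induction bs)
  case (Cons b bs)
  show ?case
  proof (cases "bs = []")
    case True
    then show ?thesis by (simp add: Dc)
  next
    case False
    have mult: "D (p * q) = tensor_act_right (D p) q + tensor_act_left p (D q)" for p q
      using D by (simp add: tensor_derivation_def)
    let ?t = "\<lambda>i. nc_monomial (take i (b # bs)) \<otimes>\<^sub>C nc_monomial (drop i (b # bs))"
    have "D (nc_monomial (b # bs))
        = ?t 1 + (\<Sum>i\<in>{1..<length bs}. (nc_const b * nc_X * nc_monomial (take i bs))
              \<otimes>\<^sub>C nc_monomial (drop i bs))"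
      using False Cons.IH
      by (simp add: nc_monomial_Cons mult DX Dc act_right_linear act_left_pure act_right_pure
          clinear_sum[OF clinear_act_left])
    also have "(\<Sum>i\<in>{1..<length bs}. (nc_const b * nc_X * nc_monomial (take i bs))
              \<otimes>\<^sub>C nc_monomial (drop i bs)) = (\<Sum>i\<in>{1..<length bs}. ?t (Suc i))"
      by (rule sum.cong) (use False in \<open>auto simp: nc_monomial_Cons\<close>)
    also have "\<dots> = (\<Sum>i\<in>{Suc 1..<Suc (length bs)}. ?t i)"
      by (rule sum.shift_bounds_Suc_ivl[symmetric])
    also have "?t 1 + \<dots> = (\<Sum>i\<in>{1..<Suc (length bs)}. ?t i)"
      using False by (subst (2) sum.atLeast_Suc_lessThan) auto
    finally show ?thesis by simp
  qed
qed simp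

lemma
  fixes b :: "'b::complex_algebra_1"
  shows free_difference_quotient_derivation:
      "tensor_derivation (free_difference_quotient :: 'b nc_poly \<Rightarrow> _)"
    and free_difference_quotient_X: "free_difference_quotient (nc_X :: 'b nc_poly) = 1 \<otimes>\<^sub>C 1"
    and free_difference_quotient_const: "free_difference_quotient (nc_const b) = 0"
proof -
  let ?P = "\<lambda>D. tensor_derivation D \<and> D nc_X = 1 \<otimes>\<^sub>C 1 \<and> (\<forall>b :: 'b. D (nc_const b) = 0)"
  have "\<exists>!D. ?P D"
  proof (rule ex_ex1I)
    show "\<exists>D. ?P D" using tensor_derivation_exists by metis
    fix D D' assume DD': "?P D" "?P D'"
    show "D = D'"
    proof
      fix p
      show "D p = D' p"
        by (rule clinear_nc_poly_eqI)
          (use DD' in \<open>auto simp: tensor_derivation_monomial tensor_derivation_def\<close>)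
    qed
  qed
  from theI'[OF this] show "tensor_derivation (free_difference_quotient :: 'b nc_poly \<Rightarrow> _)"
    "free_difference_quotient (nc_X :: 'b nc_poly) = 1 \<otimes>\<^sub>C 1" "free_difference_quotient (nc_const b) = 0"
    unfolding free_difference_quotient_def by blast+
qed

lemmas free_difference_quotient_monomial = tensor_derivation_monomial
  [OF free_difference_quotient_derivation free_difference_quotient_X free_difference_quotient_const]

lemma clinear_free_difference_quotient: "clinear free_difference_quotient"
  and free_difference_quotient_mult: "free_difference_quotient (p * q)
    = tensor_act_right (free_difference_quotient p) q + tensor_act_left p (free_difference_quotient q)"
  using free_difference_quotient_derivation by (auto simp: tensor_derivation_def)


section \<open>The cyclic derivative\<close>

text \<open>The linear map with \<open>a \<otimes> b \<mapsto> b c a\<close>.  Flipping and multiplying out \<open>t c\<close> or \<open>c t\<close> both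
  give \<open>sandwich c t\<close>, which makes \<^const>\<open>cyclic_derivative\<close> blind to the order of a product.\<close>

definition sandwich :: "'a::complex_algebra_1 \<Rightarrow> ('a, 'a) tensor \<Rightarrow> 'a" where
  "sandwich c = tensor_lift (\<lambda>a b. b * c * a)"

lemma clinear_sandwich: "clinear (sandwich c)"
  and sandwich_pure: "sandwich c (a \<otimes>\<^sub>C b) = b * c * a"
  unfolding sandwich_def
  using bilinear_map.clinear_tensor_lift[OF bilinear_reversed_insert]
    bilinear_map.tensor_lift_pure[OF bilinear_reversed_insert] by auto

lemma clinear_flip: "clinear tensor_flip"
  and flip_pure: "tensor_flip (a \<otimes>\<^sub>C b) = b \<otimes>\<^sub>C a"
  unfolding tensor_flip_def
  using bilinear_map.clinear_tensor_lift[OF bilinear_flip]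
    bilinear_map.tensor_lift_pure[OF bilinear_flip] by auto

lemma clinear_tensor_mult: "clinear tensor_mult"
  and tensor_mult_pure: "tensor_mult (a \<otimes>\<^sub>C b) = a * b"
  unfolding tensor_mult_def
  using bilinear_map.clinear_tensor_lift[OF bilinear_mult]
    bilinear_map.tensor_lift_pure[OF bilinear_mult] by auto

lemma clinear_mult_flip: "clinear (\<lambda>t. tensor_mult (tensor_flip t))"
  by (rule clinear_compose[OF clinear_flip clinear_tensor_mult])

lemma mult_flip_act_right: "tensor_mult (tensor_flip (tensor_act_right t q)) = sandwich q t"
  by (rule clinear_tensor_eqI[OF clinear_compose[OF clinear_act_right clinear_mult_flip]
        clinear_sandwich])
    (simp add: act_right_pure flip_pure tensor_mult_pure sandwich_pure)

lemma mult_flip_act_left: "tensor_mult (tensor_flip (tensor_act_left p t)) = sandwich p t"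
  by (rule clinear_tensor_eqI[OF clinear_compose[OF clinear_act_left clinear_mult_flip]
        clinear_sandwich])
    (simp add: act_left_pure flip_pure tensor_mult_pure sandwich_pure mult.assoc)

lemma clinear_cyclic_derivative: "clinear cyclic_derivative"
  unfolding cyclic_derivative_def comp_def
  using clinear_compose[OF clinear_free_difference_quotient clinear_mult_flip] by simp

lemma cyclic_derivative_mult:
  "cyclic_derivative (p * q)
    = sandwich q (free_difference_quotient p) + sandwich p (free_difference_quotient q)"
  by (simp add: cyclic_derivative_def free_difference_quotient_mult clinear_add[OF clinear_mult_flip]
      mult_flip_act_right mult_flip_act_left)

lemma cyclic_derivative_commutator: "cyclic_derivative (p * q - q * p) = 0"
  by (simp add: clinear_diff[OF clinear_cyclic_derivative] cyclic_derivative_mult)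

lemma cyclic_derivative_commutator_span: "c \<in> commutator_span \<Longrightarrow> cyclic_derivative c = 0"
  unfolding commutator_span_def
  by (rule clinear_eq_on_span[OF clinear_cyclic_derivative clinear_zero_fun])
    (auto simp: cyclic_derivative_commutator)

lemma cyclic_derivative_const: "cyclic_derivative (nc_const b) = 0"
  by (simp add: cyclic_derivative_def free_difference_quotient_const clinear_zero[OF clinear_mult_flip])

lemma cyclic_derivative_monomial_X:
  assumes "bs \<noteq> []"
  shows "cyclic_derivative (nc_monomial bs * nc_X) = (\<Sum>i<length bs. nc_monomial (rotate i bs))"
proof -
  have "cyclic_derivative (nc_monomial bs * nc_X)
      = (\<Sum>i\<in>{1..<length bs}. nc_monomial (drop i bs) * nc_X * nc_monomial (take i bs))
        + nc_monomial bs"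
    by (simp add: cyclic_derivative_mult free_difference_quotient_X sandwich_pure assms
        free_difference_quotient_monomial clinear_sum[OF clinear_sandwich])
  also have "(\<Sum>i\<in>{1..<length bs}. nc_monomial (drop i bs) * nc_X * nc_monomial (take i bs))
      = (\<Sum>i\<in>{1..<length bs}. nc_monomial (rotate i bs))"
    by (rule sum.cong) (auto simp: rotate_drop_take nc_monomial_append assms)
  also have "\<dots> + nc_monomial bs = (\<Sum>i\<in>{0..<length bs}. nc_monomial (rotate i bs))"
    using assms by (simp add: sum.atLeast_Suc_lessThan add.commute)
  finally show ?thesis by (simp add: atLeast0LessThan)
qed


section \<open>The cyclic rotation\<close>

text \<open>The rotation is \<open>\<rho> p = \<epsilon> p + R (\<partial> p)\<close> with \<open>R (a \<otimes> b) = b X \<epsilon> a\<close>, where \<open>\<epsilon>\<close> is the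
  homomorphism that fixes the constants and maps \<open>X\<close> to \<open>0\<close>.\<close>

lemma rotation_exists:
  obtains r :: "'b::complex_algebra_1 nc_poly \<Rightarrow> 'b nc_poly"
  where "clinear r" "\<And>bs. bs \<noteq> [] \<Longrightarrow> r (nc_monomial bs) = nc_monomial (rotate1 bs)"
proof -
  obtain \<epsilon> :: "'b nc_poly \<Rightarrow> 'b nc_poly" where hom: "algebra_hom \<epsilon>"
    and const: "\<And>b. \<epsilon> (nc_const b) = nc_const b" and X: "\<epsilon> nc_X = 0"
    using nc_poly_universal[OF algebra_hom_nc_const] by metis
  have lin: "clinear \<epsilon>" and mult: "\<epsilon> (p * q) = \<epsilon> p * \<epsilon> q" for p q
    using hom by (auto simp: algebra_hom_def)
  interpret R: bilinear_map "\<lambda>a b. b * nc_X * \<epsilon> a"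
    by (rule bilinear_mapI) (simp_all add: bilinear_simps clinear_add[OF lin] clinear_scale[OF lin])
  define R where "R = tensor_lift (\<lambda>a b. b * nc_X * \<epsilon> a)"
  note R = R.clinear_tensor_lift[folded R_def] R.tensor_lift_pure[folded R_def]
  define r where "r p = \<epsilon> p + R (free_difference_quotient p)" for p
  have "clinear r"
    unfolding r_def by (intro clinear_plus lin clinear_compose[OF clinear_free_difference_quotient R(1)])
  moreover have "r (nc_monomial bs) = nc_monomial (rotate1 bs)" if bs: "bs \<noteq> []" for bs
  proof (cases "tl bs = []")
    case True
    with bs obtain b where "bs = [b]" by (cases bs) auto
    then show ?thesis
      by (simp add: r_def const free_difference_quotient_const clinear_zero[OF R(1)])
  next
    case False
    with bs obtain b cs where eq: "bs = b # cs" and cs: "cs \<noteq> []" by (cases bs) auto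
    \<comment> \<open>Only the first term of the free difference quotient survives, as \<open>\<epsilon>\<close> kills \<open>X\<close>.\<close>
    have "R (tensor_act_left (nc_const b * nc_X) t) = 0" for t
      by (rule clinear_tensor_eqI[OF clinear_compose[OF clinear_act_left R(1)]
            clinear_zero_fun])
        (simp add: act_left_pure R(2) mult X)
    then show ?thesis
      by (simp add: eq cs r_def nc_monomial_Cons free_difference_quotient_mult mult X const
          free_difference_quotient_const free_difference_quotient_X act_right_linear act_left_pure
          act_right_pure clinear_add[OF R(1)] R(2) nc_monomial_append)
  qed
  ultimately show thesis by (rule that)
qed

lemma clinear_cyclic_rotation: "clinear (cyclic_rotation :: 'b::complex_algebra_1 nc_poly \<Rightarrow> _)"
  and cyclic_rotation_monomial:
    "bs \<noteq> [] \<Longrightarrow> cyclic_rotation (nc_monomial bs :: 'b nc_poly) = nc_monomial (rotate1 bs)"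
proof -
  let ?P = "\<lambda>r :: 'b nc_poly \<Rightarrow> 'b nc_poly.
    clinear r \<and> (\<forall>bs. bs \<noteq> [] \<longrightarrow> r (nc_monomial bs) = nc_monomial (rotate1 bs))"
  have "\<exists>!r. ?P r"
  proof (rule ex_ex1I)
    show "\<exists>r. ?P r" using rotation_exists by metis
    show "r = r'" if "?P r" "?P r'" for r r'
      by (rule ext, rule clinear_nc_poly_eqI[of r r']) (use that in auto)
  qed
  from theI'[OF this] show "clinear (cyclic_rotation :: 'b nc_poly \<Rightarrow> _)"
    "bs \<noteq> [] \<Longrightarrow> cyclic_rotation (nc_monomial bs :: 'b nc_poly) = nc_monomial (rotate1 bs)"
    unfolding cyclic_rotation_def by blast+
qed

lemma cyclic_rotation_funpow_monomial:
  "bs \<noteq> [] \<Longrightarrow> (cyclic_rotation ^^ i) (nc_monomial bs) = nc_monomial (rotate i bs)"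
  by (induction i) (simp_all add: cyclic_rotation_monomial)

lemma clinear_nc_Theta: "clinear nc_Theta"
  unfolding nc_Theta_def[abs_def] by (rule clinear_minus[OF clinear_id clinear_cyclic_rotation])


section \<open>The grading by the number of indeterminates\<close>

text \<open>The span of the monomials in which \<open>X\<close> occurs \<open>n\<close> times; these have \<open>n + 1\<close> coefficients.\<close>

definition homogeneous :: "nat \<Rightarrow> 'b::complex_algebra_1 nc_poly set" where
  "homogeneous n = complex_vector.span {nc_monomial bs | bs. length bs = Suc n}"

lemma subspace_homogeneous: "complex_vector.subspace (homogeneous n)"
  by (simp add: homogeneous_def complex_vector.subspace_span)

lemma monomial_homogeneous: "length bs = Suc n \<Longrightarrow> nc_monomial bs \<in> homogeneous n"
  unfolding homogeneous_def by (rule complex_vector.span_base) blast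

lemma clinear_homogeneous_eqI:
  assumes "clinear f" "clinear g"
    "\<And>bs. length bs = Suc n \<Longrightarrow> f (nc_monomial bs) = g (nc_monomial bs)" "v \<in> homogeneous n"
  shows "f v = g v"
  by (rule clinear_eq_on_span[OF assms(1,2) _ assms(4)[unfolded homogeneous_def]])
    (auto simp: assms(3))

lemma cyclic_rotation_homogeneous: "v \<in> homogeneous n \<Longrightarrow> cyclic_rotation v \<in> homogeneous n"
  by (rule clinear_span_mem[OF clinear_cyclic_rotation subspace_homogeneous,
        of "{nc_monomial bs | bs. length bs = Suc n}"])
    (auto simp: cyclic_rotation_monomial monomial_homogeneous homogeneous_def[symmetric]
      simp flip: length_greater_0_conv)

lemma cyclic_rotation_funpow_homogeneous:
  "v \<in> homogeneous n \<Longrightarrow> (cyclic_rotation ^^ i) v \<in> homogeneous n"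
  by (induction i) (simp_all add: cyclic_rotation_homogeneous)

lemma cyclic_rotation_period: "v \<in> homogeneous n \<Longrightarrow> (cyclic_rotation ^^ Suc n) v = v"
proof (rule clinear_homogeneous_eqI[OF clinear_funpow[OF clinear_cyclic_rotation] clinear_id])
  show "(cyclic_rotation ^^ Suc n) (nc_monomial bs) = nc_monomial bs" if "length bs = Suc n" for bs
    using that by (subst cyclic_rotation_funpow_monomial) (auto simp: rotate_id simp del: rotate_Suc)
qed

lemma cyclic_derivative_homogeneous_X:
  assumes "v \<in> homogeneous n"
  shows "cyclic_derivative (v * nc_X) = (\<Sum>i<Suc n. (cyclic_rotation ^^ i) v)"
proof (rule clinear_homogeneous_eqI[OF _ _ _ assms])
  show "clinear (\<lambda>v. cyclic_derivative (v * nc_X))"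
    by (rule clinear_compose[OF clinear_mult_right clinear_cyclic_derivative])
  show "clinear (\<lambda>v. \<Sum>i<Suc n. (cyclic_rotation ^^ i) v)"
    by (intro clinear_sum_fun clinear_funpow clinear_cyclic_rotation)
  show "cyclic_derivative (nc_monomial bs * nc_X) = (\<Sum>i<Suc n. (cyclic_rotation ^^ i) (nc_monomial bs))"
    if "length bs = Suc n" for bs
  proof -
    from that have "bs \<noteq> []" by auto
    with that show ?thesis
      by (simp add: cyclic_derivative_monomial_X cyclic_rotation_funpow_monomial
          del: sum.lessThan_Suc)
  qed
qed

lemma cyclic_rotation_orbit_sum:
  assumes "v \<in> homogeneous n"
  shows "cyclic_rotation (\<Sum>i<Suc n. (cyclic_rotation ^^ i) v) = (\<Sum>i<Suc n. (cyclic_rotation ^^ i) v)"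
proof -
  have "cyclic_rotation (\<Sum>i<Suc n. (cyclic_rotation ^^ i) v)
      = (\<Sum>i<n. (cyclic_rotation ^^ Suc i) v) + (cyclic_rotation ^^ Suc n) v"
    by (simp add: clinear_sum[OF clinear_cyclic_rotation] clinear_add[OF clinear_cyclic_rotation])
  also have "\<dots> = (\<Sum>i<Suc n. (cyclic_rotation ^^ i) v)"
    by (subst cyclic_rotation_period[OF assms]) (simp add: sum.lessThan_Suc_shift add.commute
        del: sum.lessThan_Suc)
  finally show ?thesis .
qed

text \<open>Composing the free difference quotient with \<open>a \<otimes> b \<mapsto> a X b\<close> multiplies a monomial by the
  number of occurrences of \<open>X\<close> in it.\<close>

definition number_operator :: "'b::complex_algebra_1 nc_poly \<Rightarrow> 'b nc_poly" where
  "number_operator p = tensor_lift (\<lambda>a b. a * nc_X * b) (free_difference_quotient p)"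

lemma clinear_number_operator: "clinear number_operator"
  unfolding number_operator_def
  by (rule clinear_compose[OF clinear_free_difference_quotient
        bilinear_map.clinear_tensor_lift[OF bilinear_insert]])

lemma number_operator_homogeneous:
  assumes "v \<in> homogeneous n"
  shows "number_operator v = of_nat n *\<^sub>C v"
proof (rule clinear_homogeneous_eqI[OF clinear_number_operator clinear_scale_fun[OF clinear_id] _ assms])
  fix bs :: "'a list"
  assume len: "length bs = Suc n"
  then have "bs \<noteq> []" by auto
  then have "number_operator (nc_monomial bs)
      = (\<Sum>i\<in>{1..<length bs}. nc_monomial (take i bs) * nc_X * nc_monomial (drop i bs))"
    by (simp add: number_operator_def free_difference_quotient_monomial
        clinear_sum[OF bilinear_map.clinear_tensor_lift[OF bilinear_insert]]
        bilinear_map.tensor_lift_pure[OF bilinear_insert])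
  also have "\<dots> = (\<Sum>i\<in>{1..<length bs}. nc_monomial bs)"
    by (rule sum.cong) (auto simp: nc_monomial_append[symmetric] \<open>bs \<noteq> []\<close>)
  also have "\<dots> = of_nat n *\<^sub>C nc_monomial bs"
    by (simp add: complex_vector.sum_constant_scale len)
  finally show "number_operator (nc_monomial bs) = of_nat n *\<^sub>C nc_monomial bs" .
qed

text \<open>Eigenvectors for distinct eigenvalues: applying \<^const>\<open>number_operator\<close> minus \<open>K\<close> to a
  vanishing sum removes the component of degree \<open>K\<close> and rescales the others by nonzero factors.\<close>

lemma homogeneous_independent:
  assumes "\<And>n. v n \<in> homogeneous n" "(\<Sum>n<K. v n) = 0" "n < K"
  shows "v n = 0"
  using assms
proof (induction K arbitrary: v n)
  case (Suc K)
  let ?w = "\<lambda>n. (of_nat n - of_nat K) *\<^sub>C v n"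
  have "(\<Sum>n<Suc K. ?w n) = number_operator (\<Sum>n<Suc K. v n) - of_nat K *\<^sub>C (\<Sum>n<Suc K. v n)"
    unfolding clinear_sum[OF clinear_number_operator] number_operator_homogeneous[OF Suc.prems(1)]
    by (simp only: complex_vector.scale_left_diff_distrib sum_subtractf complex_vector.scale_sum_right)
  then have "(\<Sum>n<Suc K. ?w n) = 0"
    by (simp only: Suc.prems(2)) (simp add: clinear_zero[OF clinear_number_operator])
  then have sum: "(\<Sum>n<K. ?w n) = 0" by simp
  have "?w n = 0" if "n < K" for n
    by (rule Suc.IH[OF _ sum that])
      (rule complex_vector.subspace_scale[OF subspace_homogeneous Suc.prems(1)])
  then have zero: "v n = 0" if "n < K" for n
    using that by fastforce
  with Suc.prems(2) have "v K = 0" by simp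
  with zero Suc.prems(3) show ?case by (cases "n = K") auto
qed simp

text \<open>The components in the set \<open>?W\<close> are required to vanish from \<open>K\<close> on, so that two sums can be
  extended to a common range and added.\<close>

lemma homogeneous_decomposition:
  fixes p :: "'b::complex_algebra_1 nc_poly"
  obtains v K where "\<And>n. v n \<in> homogeneous n" "p = (\<Sum>n<K. v n)"
proof -
  let ?W = "{p :: 'b nc_poly. \<exists>v K. (\<forall>n. v n \<in> homogeneous n) \<and> (\<forall>n\<ge>K. v n = 0) \<and> p = (\<Sum>n<K. v n)}"
  have "complex_vector.subspace ?W"
  proof (rule complex_vector.subspaceI)
    show "0 \<in> ?W"
      by (rule CollectI, rule exI[of _ "\<lambda>_. 0"], rule exI[of _ 0])
        (simp add: complex_vector.subspace_0[OF subspace_homogeneous])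
  next
    fix x y assume "x \<in> ?W" "y \<in> ?W"
    then obtain v K w L where v: "\<And>n. v n \<in> homogeneous n" "\<And>n. n \<ge> K \<Longrightarrow> v n = 0" "x = (\<Sum>n<K. v n)"
      and w: "\<And>n. w n \<in> homogeneous n" "\<And>n. n \<ge> L \<Longrightarrow> w n = 0" "y = (\<Sum>n<L. w n)"
      by auto
    have "x = (\<Sum>n<max K L. v n)" "y = (\<Sum>n<max K L. w n)"
      unfolding v(3) w(3) by (rule sum.mono_neutral_left; auto simp: v(2) w(2))+
    then have "x + y = (\<Sum>n<max K L. v n + w n)"
      by (simp add: sum.distrib)
    with v w show "x + y \<in> ?W"
      by (intro CollectI exI[of _ "\<lambda>n. v n + w n"] exI[of _ "max K L"])
        (auto intro: complex_vector.subspace_add[OF subspace_homogeneous])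
  next
    fix c x assume "x \<in> ?W"
    then obtain v K where v: "\<And>n. v n \<in> homogeneous n" "\<And>n. n \<ge> K \<Longrightarrow> v n = 0" "x = (\<Sum>n<K. v n)"
      by auto
    then show "c *\<^sub>C x \<in> ?W"
      by (intro CollectI exI[of _ "\<lambda>n. c *\<^sub>C v n"] exI[of _ K])
        (auto intro: complex_vector.subspace_scale[OF subspace_homogeneous]
          simp: complex_vector.scale_sum_right)
  qed
  moreover have "nc_monomial bs \<in> ?W" if "bs \<noteq> []" for bs
  proof (intro CollectI exI[of _ "length bs"]
      exI[of _ "\<lambda>n. if n = length bs - 1 then nc_monomial bs else 0"] conjI allI impI)
    show "(if n = length bs - 1 then nc_monomial bs else 0) \<in> homogeneous n" for n
      using that by (auto intro: monomial_homogeneous complex_vector.subspace_0[OF subspace_homogeneous])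
    show "(if n = length bs - 1 then nc_monomial bs else 0) = 0" if "length bs \<le> n" for n
      using that \<open>bs \<noteq> []\<close> by (cases bs) auto
  qed (use that in auto)
  ultimately have "p \<in> ?W" by (rule clinear_nc_poly_mem[OF clinear_id])
  then show thesis using that by blast
qed


section \<open>Exactness\<close>

lemma subspace_commutator_span: "complex_vector.subspace commutator_span"
  by (simp add: commutator_span_def complex_vector.subspace_span)

lemma commutator_mem: "p * q - q * p \<in> commutator_span"
  unfolding commutator_span_def by (rule complex_vector.span_base) blast

lemma subspace_range: "clinear f \<Longrightarrow> complex_vector.subspace (range f)"
proof (rule complex_vector.subspaceI)
  assume f: "clinear f"
  show "0 \<in> range f" by (metis clinear_zero[OF f] rangeI)
  show "x + y \<in> range f" if "x \<in> range f" "y \<in> range f" for x y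
    using that by (auto simp: clinear_add[OF f, symmetric])
  show "c *\<^sub>C x \<in> range f" if "x \<in> range f" for c x
    using that by (auto simp: clinear_scale[OF f, symmetric])
qed

lemma subspace_const_plus_commutators: "complex_vector.subspace const_plus_commutators"
proof -
  have eq: "const_plus_commutators = {x + y | x y. x \<in> range nc_const \<and> y \<in> commutator_span}"
    by (auto simp: const_plus_commutators_def)
  show ?thesis
    unfolding eq
    by (rule complex_vector.subspace_sums[OF subspace_range[OF clinear_nc_const]
          subspace_commutator_span])
qed

lemma nc_poly_decomposition:
  obtains b q c where "p = nc_const b + q * nc_X + c" "c \<in> commutator_span"
proof -
  let ?A = "{x + y | x y. x \<in> const_plus_commutators \<and> y \<in> range (\<lambda>q. q * nc_X)}"
  have "complex_vector.subspace ?A"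
    by (rule complex_vector.subspace_sums[OF subspace_const_plus_commutators
          subspace_range[OF clinear_mult_right]])
  moreover have "nc_monomial bs \<in> ?A" if "bs \<noteq> []" for bs
  proof (cases "butlast bs = []")
    case True
    with that obtain b where "bs = [b]" by (cases bs) (auto split: if_splits)
    then have "nc_monomial bs = (nc_const b + 0) + 0 * nc_X" by simp
    then show ?thesis
      using complex_vector.subspace_0[OF subspace_commutator_span]
      unfolding const_plus_commutators_def by blast
  next
    case False
    let ?u = "nc_monomial (butlast bs)" and ?b = "nc_const (last bs)"
    \<comment> \<open>The last coefficient moves to the front, modulo a commutator.\<close>
    have "nc_monomial bs = ?u * nc_X * ?b"
      using nc_monomial_append[OF False, of "[last bs]"] that by simp
    also have "\<dots> = (nc_const 0 + (?u * nc_X * ?b - ?b * (?u * nc_X))) + (?b * ?u) * nc_X"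
      by (simp add: mult.assoc clinear_zero[OF clinear_nc_const])
    finally show ?thesis
      using commutator_mem[of "?u * nc_X" ?b] unfolding const_plus_commutators_def by blast
  qed
  ultimately have "p \<in> ?A" by (rule clinear_nc_poly_mem[OF clinear_id])
  then obtain b c q where "p = (nc_const b + c) + q * nc_X" "c \<in> commutator_span"
    by (auto simp: const_plus_commutators_def)
  then show thesis using that[of b q c] by (simp add: algebra_simps)
qed

text \<open>For \<open>q = b w\<close> with \<open>b \<in> B\<close> and \<open>w = X b\<^sub>1 X \<dots> X b\<^sub>n\<close>, where \<open>n > 0\<close>, the element
  \<open>(q - \<rho> q) X\<close> is the commutator of \<open>b X\<close> and \<open>b\<^sub>1 X \<dots> X b\<^sub>n X\<close>.\<close>

lemma rotation_difference_X: "(q - cyclic_rotation q) * nc_X \<in> commutator_span"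
proof (rule clinear_nc_poly_mem[of "\<lambda>q. (q - cyclic_rotation q) * nc_X",
      OF _ subspace_commutator_span])
  show "clinear (\<lambda>q. (q - cyclic_rotation q) * nc_X)"
    by (rule clinear_compose[OF clinear_minus[OF clinear_id clinear_cyclic_rotation]
          clinear_mult_right])
  fix bs :: "'a list" assume "bs \<noteq> []"
  then obtain b cs where bs: "bs = b # cs" by (cases bs) auto
  show "(nc_monomial bs - cyclic_rotation (nc_monomial bs)) * nc_X \<in> commutator_span"
  proof (cases "cs = []")
    case True
    then show ?thesis
      by (simp add: bs cyclic_rotation_monomial[of "[b]", simplified]
          complex_vector.subspace_0[OF subspace_commutator_span])
  next
    case False
    then show ?thesis
      using commutator_mem[of "nc_const b * nc_X" "nc_monomial cs * nc_X"]
      by (simp add: bs cyclic_rotation_monomial left_diff_distrib)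
        (simp add: nc_monomial_Cons nc_monomial_append mult.assoc)
  qed
qed

lemma rotation_funpow_difference_X: "(q - (cyclic_rotation ^^ i) q) * nc_X \<in> commutator_span"
proof (induction i)
  case 0
  then show ?case by (simp add: complex_vector.subspace_0[OF subspace_commutator_span])
next
  case (Suc i)
  have "(q - (cyclic_rotation ^^ Suc i) q) * nc_X = (q - (cyclic_rotation ^^ i) q) * nc_X
      + ((cyclic_rotation ^^ i) q - cyclic_rotation ((cyclic_rotation ^^ i) q)) * nc_X"
    by (simp flip: distrib_right)
  then show ?case
    using complex_vector.subspace_add[OF subspace_commutator_span Suc rotation_difference_X]
    by simp
qed

text \<open>Since the orbit sum of \<open>v\<close> vanishes, \<open>(n + 1) v\<close> is the sum of the differences \<open>v - \<rho>\<^sup>i v\<close>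
  for \<open>0 \<le> i \<le> n\<close>.\<close>

lemma cyclic_derivative_zero_homogeneous:
  assumes v: "v \<in> homogeneous n" and zero: "cyclic_derivative (v * nc_X) = 0"
  shows "v * nc_X \<in> commutator_span"
proof -
  have "(\<Sum>i<Suc n. (v - (cyclic_rotation ^^ i) v) * nc_X)
      = of_nat (Suc n) *\<^sub>C (v * nc_X) - (\<Sum>i<Suc n. (cyclic_rotation ^^ i) v) * nc_X"
    by (simp add: left_diff_distrib sum_subtractf sum_distrib_right
        complex_vector.sum_constant_scale del: sum.lessThan_Suc of_nat_Suc)
  also have "\<dots> = of_nat (Suc n) *\<^sub>C (v * nc_X)"
    using zero by (simp add: cyclic_derivative_homogeneous_X[OF v] del: sum.lessThan_Suc of_nat_Suc)
  finally have eq: "of_nat (Suc n) *\<^sub>C (v * nc_X)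
      = (\<Sum>i<Suc n. (v - (cyclic_rotation ^^ i) v) * nc_X)" ..
  have "of_nat (Suc n) *\<^sub>C (v * nc_X) \<in> commutator_span"
    unfolding eq
    by (rule complex_vector.subspace_sum[OF subspace_commutator_span rotation_funpow_difference_X])
  from complex_vector.subspace_scale[OF subspace_commutator_span this, of "inverse (of_nat (Suc n))"]
  show ?thesis by (simp add: scaleC_scaleC scaleC_one del: of_nat_Suc)
qed

lemma cyclic_derivative_sum_X:
  assumes "\<And>n. v n \<in> homogeneous n"
  shows "cyclic_derivative ((\<Sum>n<K. v n) * nc_X) = (\<Sum>n<K. \<Sum>i<Suc n. (cyclic_rotation ^^ i) (v n))"
  by (simp add: sum_distrib_right clinear_sum[OF clinear_cyclic_derivative]
      cyclic_derivative_homogeneous_X[OF assms] del: sum.lessThan_Suc)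

lemma orbit_sum_homogeneous:
  "v \<in> homogeneous n \<Longrightarrow> (\<Sum>i<K. (cyclic_rotation ^^ i) v) \<in> homogeneous n"
  by (intro complex_vector.subspace_sum[OF subspace_homogeneous] cyclic_rotation_funpow_homogeneous)

lemma cyclic_derivative_eq_0_iff: "cyclic_derivative p = 0 \<longleftrightarrow> p \<in> const_plus_commutators"
proof
  assume "p \<in> const_plus_commutators"
  then show "cyclic_derivative p = 0"
    by (auto simp: const_plus_commutators_def clinear_add[OF clinear_cyclic_derivative]
        cyclic_derivative_const cyclic_derivative_commutator_span)
next
  assume zero: "cyclic_derivative p = 0"
  obtain b q c where p: "p = nc_const b + q * nc_X + c" and c: "c \<in> commutator_span"
    by (rule nc_poly_decomposition)
  obtain v K where v: "\<And>n. v n \<in> homogeneous n" and q: "q = (\<Sum>n<K. v n)"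
    by (rule homogeneous_decomposition) blast
  have "(\<Sum>n<K. \<Sum>i<Suc n. (cyclic_rotation ^^ i) (v n)) = 0"
    using zero by (simp add: p clinear_add[OF clinear_cyclic_derivative] cyclic_derivative_const
        cyclic_derivative_commutator_span[OF c] q cyclic_derivative_sum_X[OF v] del: sum.lessThan_Suc)
  then have "(\<Sum>i<Suc n. (cyclic_rotation ^^ i) (v n)) = 0" if "n < K" for n
    using homogeneous_independent[of "\<lambda>n. \<Sum>i<Suc n. (cyclic_rotation ^^ i) (v n)", OF
        orbit_sum_homogeneous[OF v] _ that] by blast
  then have "v n * nc_X \<in> commutator_span" if "n < K" for n
    using that cyclic_derivative_zero_homogeneous[OF v] cyclic_derivative_homogeneous_X[OF v] by metis
  then have "q * nc_X \<in> commutator_span"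
    unfolding q sum_distrib_right
    by (intro complex_vector.subspace_sum[OF subspace_commutator_span]) simp
  then have "q * nc_X + c \<in> commutator_span"
    by (rule complex_vector.subspace_add[OF subspace_commutator_span _ c])
  then show "p \<in> const_plus_commutators"
    unfolding const_plus_commutators_def p add.assoc by blast
qed

lemma nc_Theta_eq_0_iff: "nc_Theta p = 0 \<longleftrightarrow> p \<in> range cyclic_derivative"
proof
  assume "p \<in> range cyclic_derivative"
  then obtain r where r: "p = cyclic_derivative r" by auto
  obtain b q c where d: "r = nc_const b + q * nc_X + c" and c: "c \<in> commutator_span"
    by (rule nc_poly_decomposition)
  obtain v K where v: "\<And>n. v n \<in> homogeneous n" and q: "q = (\<Sum>n<K. v n)"
    by (rule homogeneous_decomposition) blast
  have "p = (\<Sum>n<K. \<Sum>i<Suc n. (cyclic_rotation ^^ i) (v n))"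
    by (simp add: r d clinear_add[OF clinear_cyclic_derivative] cyclic_derivative_const
        cyclic_derivative_commutator_span[OF c] q cyclic_derivative_sum_X[OF v] del: sum.lessThan_Suc)
  then show "nc_Theta p = 0"
    by (simp add: nc_Theta_def clinear_sum[OF clinear_cyclic_rotation, of _ "{..<K}"]
        cyclic_rotation_orbit_sum[OF v] del: sum.lessThan_Suc)
next
  assume zero: "nc_Theta p = 0"
  obtain v K where v: "\<And>n. v n \<in> homogeneous n" and p: "p = (\<Sum>n<K. v n)"
    by (rule homogeneous_decomposition) blast
  have "(\<Sum>n<K. v n - cyclic_rotation (v n)) = 0"
    using zero by (simp add: nc_Theta_def p clinear_sum[OF clinear_cyclic_rotation] sum_subtractf)
  then have "v n - cyclic_rotation (v n) = 0" if "n < K" for n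
    using homogeneous_independent[of "\<lambda>n. v n - cyclic_rotation (v n)", OF
        complex_vector.subspace_diff[OF subspace_homogeneous v cyclic_rotation_homogeneous[OF v]]
        _ that] by blast
  then have "cyclic_rotation (v n) = v n" if "n < K" for n
    using that by simp
  then have fixed: "(cyclic_rotation ^^ i) (v n) = v n" if "n < K" for n i
    using that by (induction i) simp_all
  \<comment> \<open>On invariants of degree \<open>n\<close> the orbit sum is multiplication by \<open>n + 1\<close>.\<close>
  let ?w = "\<lambda>n. inverse (of_nat (Suc n)) *\<^sub>C v n"
  have w: "?w n \<in> homogeneous n" for n
    by (rule complex_vector.subspace_scale[OF subspace_homogeneous v])
  have "(\<Sum>i<Suc n. (cyclic_rotation ^^ i) (?w n)) = v n" if "n < K" for n
    using that
    by (simp add: clinear_scale[OF clinear_funpow[OF clinear_cyclic_rotation]] fixed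
        complex_vector.sum_constant_scale scaleC_scaleC scaleC_one del: sum.lessThan_Suc of_nat_Suc)
  then have "cyclic_derivative ((\<Sum>n<K. ?w n) * nc_X) = p"
    unfolding cyclic_derivative_sum_X[of ?w, OF w] p by (intro sum.cong) auto
  then show "p \<in> range cyclic_derivative" by (metis rangeI)
qed

theorem corollary9p5:
  shows "complex_vector.subspace (const_plus_commutators :: 'b::complex_algebra_1 nc_poly set) \<and>
    clinear (cyclic_derivative :: 'b nc_poly \<Rightarrow> 'b nc_poly) \<and>
    clinear (nc_Theta :: 'b nc_poly \<Rightarrow> 'b nc_poly) \<and>
    exact_at {0} id (const_plus_commutators :: 'b nc_poly set) (id :: 'b nc_poly \<Rightarrow> 'b nc_poly) \<and>
    exact_at const_plus_commutators id UNIV (cyclic_derivative :: 'b nc_poly \<Rightarrow> 'b nc_poly) \<and>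
    exact_at UNIV (cyclic_derivative :: 'b nc_poly \<Rightarrow> 'b nc_poly) UNIV nc_Theta"
proof (intro conjI)
  show "exact_at {0} id (const_plus_commutators :: 'b nc_poly set) (id :: 'b nc_poly \<Rightarrow> 'b nc_poly)"
    using complex_vector.subspace_0[OF subspace_const_plus_commutators]
    by (auto simp: exact_at_def)
qed (auto simp: exact_at_def subspace_const_plus_commutators clinear_cyclic_derivative
    clinear_nc_Theta cyclic_derivative_eq_0_iff nc_Theta_eq_0_iff)

end
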